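(* Let $N \ge 2$ be an integer and, for $2 \le n \le N$, let $a_n$ be non-negative integers with at least one of them positive. Let $\mathcal{Q}(t) = t - \sum_{n=2}^N a_n t^n$, and let $t_{\mathcal{Q}}$ be the unique zero of the derivative $\mathcal{Q}'$ in $(0,\infty)$. Suppose a real-valued $f \in L^1(\mathbb{R}^d)$ with $\int_{\mathbb{R}^d} f \ge 0$ satisfies $$f \ge \sum_{n=2}^N a_n \left( *^n f\right).$$ Then $f$ is non-negative and satisfies $\|f\|_{L^1(\mathbb{R}^d)} \le t_{\mathcal{Q}}$.
   Context: Here $d \ge 1$ is an integer, $L^1(\mathbb{R}^d)$ is taken with respect to Lebesgue measure, and for $n \ge 1$, $*^n f = f * \cdots * f$ denotes the $n$-fold convolution of $f$ with itself ($n$ factors), where $(f*g)(x) = \int_{\mathbb{R}^d} f(y)\, g(x-y)\, dy$. Inequalities between elements of $L^1(\mathbb{R}^d)$ are understood almost everywhere. Since the $a_n$ are non-negative with at least one positive, $\mathcal{Q}'$ has exactly one zero in $(0,\infty)$, so $t_{\mathcal{Q}}$ is well defined. *)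

theory Defs
  imports "HOL-Analysis.Analysis"
begin

text \<open>
  Elements of $L^1$ are represented by Lebesgue-integrable functions.  The integrand below is
  integrable only for almost every \<open>x\<close>; on the exceptional null set the integral has the value 0.
\<close>

definition convolution :: "(real^'d \<Rightarrow> real) \<Rightarrow> (real^'d \<Rightarrow> real) \<Rightarrow> (real^'d \<Rightarrow> real)" where
  "convolution f g = (\<lambda>x. LINT y|lebesgue. f y * g (x - y))"

text \<open>The convolution of \<open>n \<ge> 1\<close> factors \<open>f\<close>; the value \<open>f\<close> at \<open>n = 0\<close> has no meaning.\<close>

definition conv_power :: "nat \<Rightarrow> (real^'d \<Rightarrow> real) \<Rightarrow> (real^'d \<Rightarrow> real)" where
  "conv_power n f = (convolution f ^^ (n - 1)) f"

lemma conv_power_1: "conv_power 1 f = f"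
  by (simp add: conv_power_def)

lemma conv_power_Suc: "n \<ge> 1 \<Longrightarrow> conv_power (Suc n) f = convolution f (conv_power n f)"
  by (cases n) (simp_all add: conv_power_def)

definition Q_poly :: "nat \<Rightarrow> (nat \<Rightarrow> nat) \<Rightarrow> real \<Rightarrow> real" where
  "Q_poly N a t = t - (\<Sum>n=2..N. real (a n) * t ^ n)"

definition t_Q :: "nat \<Rightarrow> (nat \<Rightarrow> nat) \<Rightarrow> real" where
  "t_Q N a = (THE t. t > 0 \<and> deriv (Q_poly N a) t = 0)"

lemma deriv_Q_poly:
  "deriv (Q_poly N a) t = 1 - (\<Sum>n=2..N. real (a n) * (real n * t ^ (n - 1)))"
proof (rule DERIV_imp_deriv)
  have *: "((\<lambda>t. real (a n) * t ^ n) has_field_derivative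
      real (a n) * (real n * t ^ (n - 1))) (at t)" for n
    using DERIV_cmult[OF DERIV_pow[of n t], of "real (a n)"] by simp
  show "(Q_poly N a has_field_derivative
      1 - (\<Sum>n=2..N. real (a n) * (real n * t ^ (n - 1)))) (at t)"
    unfolding Q_poly_def[abs_def] by (rule DERIV_diff[OF DERIV_ident DERIV_sum[OF *]])
qed

lemma t_Q_unique:
  assumes "\<exists>n\<in>{2..N}. a n > 0"
  shows "\<exists>!t. t > 0 \<and> deriv (Q_poly N a) t = 0"
proof -
  define S where "S t = (\<Sum>n=2..N. real (a n) * (real n * t ^ (n - 1)))" for t :: real
  obtain m where m: "m \<in> {2..N}" "a m > 0" using assms by blast
  have strict: "S s < S t" if "0 \<le> s" "s < t" for s t
    unfolding S_def
  proof (rule sum_strict_mono_ex1)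
    show "\<forall>n\<in>{2..N}. real (a n) * (real n * s ^ (n - 1)) \<le> real (a n) * (real n * t ^ (n - 1))"
      using that by (auto intro!: mult_left_mono power_mono)
    have "s ^ (m - 1) < t ^ (m - 1)"
      using that m by (intro power_strict_mono) auto
    then show "\<exists>n\<in>{2..N}. real (a n) * (real n * s ^ (n - 1)) < real (a n) * (real n * t ^ (n - 1))"
      using m by (intro bexI[of _ m]) auto
  qed simp
  have S0: "S 0 = 0" unfolding S_def by (intro sum.neutral) auto
  have "1 * (1 * 1) \<le> real (a m) * (real m * 1 ^ (m - 1))"
    using m by (intro mult_mono) auto
  also have "\<dots> \<le> S 1" unfolding S_def
    using m by (intro member_le_sum) auto
  finally have S1: "1 \<le> S 1" by simp
  have "continuous_on {0..1} S"
    unfolding S_def by (intro continuous_intros)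
  then have "\<exists>t\<ge>0. t \<le> 1 \<and> S t = 1"
    using IVT'[of S 0 1 1] S0 S1 by simp
  then obtain t where t: "0 \<le> t" "S t = 1" by blast
  with S0 have "t > 0" by (cases "t = 0") auto
  have uniq: "s = t" if "s > 0" "S s = 1" for s
    using strict[of s t] strict[of t s] that t by linarith
  have "deriv (Q_poly N a) s = 1 - S s" for s
    unfolding deriv_Q_poly S_def ..
  then have iff: "deriv (Q_poly N a) s = 0 \<longleftrightarrow> S s = 1" for s
    by simp
  show ?thesis
    unfolding iff
  proof (rule ex1I)
    show "t > 0 \<and> S t = 1" using \<open>t > 0\<close> t by blast
    show "s = t" if "s > 0 \<and> S s = 1" for s using uniq that by blast
  qed
qed

end

theory Submission
  imports "HOL-Probability.Characteristic_Functions" Defs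
begin

text \<open>
  Write \<open>F\<close> for the Fourier transform of \<open>f\<close>, \<open>T\<close> for the critical point of
  \<open>Q(t) = t - \<Sum> a\<^sub>n t\<^sup>n\<close>, and \<open>u = f - \<Sum> a\<^sub>n (*\<^sup>n f) \<ge> 0\<close>.  The Fourier transform of
  \<open>u\<close> is \<open>Q \<circ> F\<close>; at frequency \<open>0\<close> this says \<open>\<integral>u = Q(\<integral>f)\<close>, which is at most \<open>Q(T)\<close> because
  \<open>Q\<close> is concave on \<open>[0, \<infinity>)\<close> with maximum at \<open>T\<close> (\<open>Q_poly_le_t_Q\<close>).

  The equation \<open>g = u + \<Sum> a\<^sub>n (*\<^sup>n g)\<close> has a solution of the desired kind: iterating its right-hand
  side from \<open>0\<close> gives an increasing sequence of non-negative functions whose integrals never exceed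
  \<open>T\<close>, since \<open>\<integral>u + \<Sum> a\<^sub>n T\<^sup>n \<le> Q(T) + \<Sum> a\<^sub>n T\<^sup>n = T\<close>.  Its limit \<open>g \<ge> 0\<close> satisfies \<open>\<integral>g \<le> T\<close>, and
  the transform \<open>G\<close> of \<open>g\<close> satisfies \<open>Q \<circ> G = Q \<circ> F\<close> (\<open>ex_positive_solution\<close>).  It remains to
  show \<open>F = G\<close>; then \<open>f = g\<close> by Fourier uniqueness and both claims follow.

  On the open disc of radius \<open>T\<close> the polynomial \<open>Q\<close> is injective, since there the derivative of
  \<open>\<Sum> a\<^sub>n z\<^sup>n\<close> is smaller than \<open>1\<close> in modulus (\<open>Q_poly_inj_on_disc\<close>).  For \<open>k \<noteq> 0\<close> the strict inequality
  \<open>|G k| < T\<close> holds, because a non-negative density cannot be concentrated on the null set where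
  the character has one fixed phase (\<open>norm_fourier_less\<close>).  So away from \<open>0\<close> the conditions
  \<open>F k = G k\<close> and \<open>|F k| < T\<close> are equivalent: the first is closed, the second is open, and on
  every ray the second holds far out by the Riemann--Lebesgue lemma.  By connectedness \<open>F\<close> and
  \<open>G\<close> agree on the ray from \<open>k\<close> to infinity.  Rays are used rather than the complement of \<open>0\<close>
  because the latter is disconnected in dimension one.

  The analytic tools are continuity of translation in \<open>L\<^sup>1\<close>, the Riemann--Lebesgue lemma, uniqueness
  of the Fourier transform on \<open>L\<^sup>1\<close> and the convolution theorem.
\<close>

section \<open>Affine changes of variables\<close>

lemma nn_integral_lborel_affine:
  fixes f :: "'a::euclidean_space \<Rightarrow> ennreal"
  assumes [measurable]: "f \<in> borel_measurable borel" and c: "c \<noteq> 0"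
  shows "(\<integral>\<^sup>+x. f x \<partial>lborel) = ennreal (\<bar>c\<bar> ^ DIM('a)) * (\<integral>\<^sup>+x. f (t + c *\<^sub>R x) \<partial>lborel)"
  by (subst lborel_affine[OF c, of t])
     (simp add: nn_integral_density nn_integral_distr nn_integral_cmult)

lemma lborel_integrable_affine:
  fixes f :: "'a::euclidean_space \<Rightarrow> 'b :: {banach, second_countable_topology}"
  assumes f: "integrable lborel f" and c: "c \<noteq> 0"
  shows "integrable lborel (\<lambda>x. f (t + c *\<^sub>R x))"
proof -
  have m[measurable]: "f \<in> borel_measurable borel" using f by auto
  have "(\<integral>\<^sup>+x. ennreal (norm (f x)) \<partial>lborel) < \<infinity>"
    using f unfolding integrable_iff_bounded by auto
  then have "(\<integral>\<^sup>+x. ennreal (norm (f (t + c *\<^sub>R x))) \<partial>lborel) < \<infinity>"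
    by (subst (asm) nn_integral_lborel_affine[OF _ c, of _ t])
       (use c in \<open>auto simp: ennreal_mult_less_top\<close>)
  then show ?thesis
    unfolding integrable_iff_bounded by auto
qed

lemma lborel_integral_affine:
  fixes f :: "'a::euclidean_space \<Rightarrow> 'b :: {banach, second_countable_topology}"
  assumes f: "integrable lborel f" and c: "c \<noteq> 0"
  shows "(\<integral>x. f x \<partial>lborel) = (\<bar>c\<bar> ^ DIM('a)) *\<^sub>R (\<integral>x. f (t + c *\<^sub>R x) \<partial>lborel)"
proof -
  have m[measurable]: "f \<in> borel_measurable borel" using f by auto
  show ?thesis
    using lborel_integrable_affine[OF f c, of t]
    by (subst lborel_affine[OF c, of t]) (simp add: integral_density integral_distr)
qed

lemma AE_lborel_affine:
  fixes P :: "'a::euclidean_space \<Rightarrow> bool"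
  assumes P: "AE x in lborel. P x" and c: "c \<noteq> 0"
  shows "AE x in lborel. P (t + c *\<^sub>R x)"
proof -
  obtain N where N: "{x \<in> space lborel. \<not> P x} \<subseteq> N" "emeasure lborel N = 0" "N \<in> sets lborel"
    using AE_E[OF P] by blast
  have [measurable]: "N \<in> sets borel" using N by simp
  have "(\<integral>\<^sup>+x. indicator N x \<partial>lborel) = 0" using N by simp
  then have "(\<integral>\<^sup>+x. indicator N (t + c *\<^sub>R x) \<partial>lborel) = 0"
    by (subst (asm) nn_integral_lborel_affine[OF _ c, of _ t]) (use c in auto)
  then have "AE x in lborel. indicator N (t + c *\<^sub>R x) = (0::ennreal)"
    by (subst (asm) nn_integral_0_iff_AE) auto
  then show ?thesis
    using N(1) by (auto simp: indicator_def split: if_splits elim!: eventually_mono)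
qed

lemma lborel_integrable_translate:
  fixes f :: "'a::euclidean_space \<Rightarrow> 'b :: {banach, second_countable_topology}"
  assumes "integrable lborel f"
  shows "integrable lborel (\<lambda>x. f (x - v))"
  using lborel_integrable_affine[OF assms, of 1 "- v"] by simp

lemma lborel_integral_translate:
  fixes f :: "'a::euclidean_space \<Rightarrow> 'b :: {banach, second_countable_topology}"
  assumes "integrable lborel f"
  shows "(\<integral>x. f (x - v) \<partial>lborel) = (\<integral>x. f x \<partial>lborel)"
  using lborel_integral_affine[OF assms, of 1 "- v"] by simp

section \<open>Continuity of translation in \<open>L\<^sup>1\<close>\<close>

text \<open>
  Openness gives \<open>1\<^sub>U(x - v) \<rightarrow> 1\<^sub>U(x)\<close> as \<open>v \<rightarrow> 0\<close> at every point \<open>x\<close> of \<open>U\<close>.  Outside \<open>U\<close> pointwise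
  convergence can fail, on a boundary that may have positive measure, but invariance of the
  measure makes the mass gained there equal to the mass lost inside \<open>U\<close>.
\<close>

lemma translation_continuous_indicator_open:
  fixes U :: "'a::euclidean_space set"
  assumes U: "open U" "emeasure lborel U < \<infinity>"
  shows "((\<lambda>v. \<integral>x. \<bar>indicator U (x - v) - indicator U x :: real\<bar> \<partial>lborel) \<longlongrightarrow> 0) (at 0)"
proof (rule tendsto_at_iff_sequentially[THEN iffD2], intro allI impI)
  fix V :: "nat \<Rightarrow> 'a" assume "\<forall>i. V i \<in> UNIV - {0}" and V: "V \<longlonglongrightarrow> 0"
  have [measurable]: "U \<in> sets borel" using U by auto
  have iU: "integrable lborel (indicator U :: 'a \<Rightarrow> real)" using U by (simp add: integrable_indicator_iff)
  have iUv: "integrable lborel (\<lambda>x. indicator U (x - v) :: real)" for v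
    by (rule lborel_integrable_translate[OF iU])
  have iUU: "integrable lborel (\<lambda>x. indicator U x * indicator U (x - v) :: real)" for v
    by (rule Bochner_Integration.integrable_bound[OF iU]) (auto simp: indicator_def)
  \<comment> \<open>\<open>\<bar>1\<^sub>A - 1\<^sub>B\<bar> = 1\<^sub>A + 1\<^sub>B - 2 1\<^sub>A 1\<^sub>B\<close>, and both sets have the same measure.\<close>
  have eq: "(\<integral>x. \<bar>indicator U (x - v) - indicator U x :: real\<bar> \<partial>lborel)
      = 2 * measure lborel U - 2 * (\<integral>x. indicator U x * indicator U (x - v) \<partial>lborel)" for v
  proof -
    have "(\<integral>x. \<bar>indicator U (x - v) - indicator U x :: real\<bar> \<partial>lborel)
       = (\<integral>x. indicator U (x - v) + indicator U x - 2 * (indicator U x * indicator U (x - v)) \<partial>lborel)"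
      by (intro Bochner_Integration.integral_cong) (auto simp: indicator_def)
    also have "\<dots> = (\<integral>x. indicator U (x - v) \<partial>lborel) + (\<integral>x. indicator U x \<partial>lborel)
        - 2 * (\<integral>x. indicator U x * indicator U (x - v) \<partial>lborel)"
      using iU iUv iUU by simp
    finally show ?thesis
      using lborel_integral_translate[OF iU, of v] by simp
  qed
  have "(\<lambda>i. \<integral>x. indicator U x * indicator U (x - V i) \<partial>lborel)
      \<longlonglongrightarrow> (\<integral>x. indicator U x \<partial>(lborel :: 'a measure) :: real)"
  proof (rule integral_dominated_convergence[where w="indicator U"])
    show "AE x in lborel. (\<lambda>i. indicator U x * indicator U (x - V i)) \<longlonglongrightarrow> (indicator U x :: real)"
    proof (intro AE_I2)
      fix x :: 'a
      show "(\<lambda>i. indicator U x * indicator U (x - V i)) \<longlonglongrightarrow> (indicator U x :: real)"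
      proof (cases "x \<in> U")
        case True
        have "(\<lambda>i. x - V i) \<longlonglongrightarrow> x" using tendsto_diff[OF tendsto_const V, of x] by simp
        then have "eventually (\<lambda>i. x - V i \<in> U) sequentially"
          using U(1) True by (rule topological_tendstoD)
        then show ?thesis
          using True by (intro tendsto_eventually) (auto elim!: eventually_mono)
      qed simp
    qed
  qed (use iU in \<open>auto simp: indicator_def\<close>)
  then have "(\<lambda>i. 2 * measure lborel U - 2 * (\<integral>x. indicator U x * indicator U (x - V i) \<partial>lborel))
      \<longlonglongrightarrow> 2 * measure lborel U - 2 * measure lborel U"
    by (intro tendsto_intros) simp
  then show "((\<lambda>v. \<integral>x. \<bar>indicator U (x - v) - indicator U x :: real\<bar> \<partial>lborel) \<circ> V) \<longlonglongrightarrow> 0"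
    by (simp add: eq o_def)
qed

text \<open>
  The modulus of continuity is stable under \<open>L\<^sup>1\<close> approximation: two applications of the triangle
  inequality, one at \<open>x\<close> and one at \<open>x - v\<close>.
\<close>

lemma translation_continuous_perturb:
  fixes f g :: "'a::euclidean_space \<Rightarrow> real"
  assumes f: "integrable lborel f" and g: "integrable lborel g"
  shows "(\<integral>x. \<bar>f (x - v) - f x\<bar> \<partial>lborel)
     \<le> (\<integral>x. \<bar>g (x - v) - g x\<bar> \<partial>lborel) + 2 * (\<integral>x. \<bar>f x - g x\<bar> \<partial>lborel)"
proof -
  note tr = lborel_integrable_translate
  have fg: "integrable lborel (\<lambda>x. \<bar>f x - g x\<bar>)" using f g by auto
  have i: "integrable lborel (\<lambda>x. \<bar>g (x - v) - g x\<bar>)" "integrable lborel (\<lambda>x. \<bar>f (x - v) - f x\<bar>)"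
    using f g tr[OF f, of v] tr[OF g, of v] by auto
  have "(\<integral>x. \<bar>f (x - v) - f x\<bar> \<partial>lborel)
     \<le> (\<integral>x. \<bar>g (x - v) - g x\<bar> + \<bar>f (x - v) - g (x - v)\<bar> + \<bar>f x - g x\<bar> \<partial>lborel)"
    using i fg tr[OF fg, of v] by (intro integral_mono) auto
  also have "\<dots> = (\<integral>x. \<bar>g (x - v) - g x\<bar> \<partial>lborel)
      + (\<integral>x. \<bar>f (x - v) - g (x - v)\<bar> \<partial>lborel) + (\<integral>x. \<bar>f x - g x\<bar> \<partial>lborel)"
    using i fg tr[OF fg, of v] by simp
  finally show ?thesis using lborel_integral_translate[OF fg, of v] by simp
qed

lemma tendsto_0_if_approximable:
  fixes F :: "'a \<Rightarrow> real"
  assumes nonneg: "\<And>v. F v \<ge> 0"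
    and approx: "\<And>e. e > 0 \<Longrightarrow> \<exists>G. (G \<longlongrightarrow> 0) X \<and> (\<forall>v. F v \<le> G v + e)"
  shows "(F \<longlongrightarrow> 0) X"
proof (rule tendstoI)
  fix e :: real assume e: "e > 0"
  obtain G where G: "(G \<longlongrightarrow> 0) X" "\<And>v. F v \<le> G v + e / 2"
    using approx[of "e / 2"] e by auto
  have "eventually (\<lambda>v. G v < e / 2) X"
    using G(1) e by (intro order_tendstoD(2)) auto
  then show "eventually (\<lambda>v. dist (F v) 0 < e) X"
  proof eventually_elim
    case (elim v)
    then have "F v < e" using G(2)[of v] by linarith
    then show ?case using nonneg[of v] by (simp add: dist_real_def)
  qed
qed

text \<open>
  Indicators of sets of finite measure are approximated from outside by open sets, and integrable
  functions by simple ones.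
\<close>

theorem translation_continuous_L1:
  fixes f :: "'a::euclidean_space \<Rightarrow> real"
  assumes "integrable lborel f"
  shows "((\<lambda>v. \<integral>x. \<bar>f (x - v) - f x\<bar> \<partial>lborel) \<longlongrightarrow> 0) (at 0)"
  using assms
proof (induction rule: integrable_induct)
  case (base A c)
  have [measurable]: "A \<in> sets borel" using base by simp
  have iA: "integrable lborel (indicator A :: 'a \<Rightarrow> real)" using base by (simp add: integrable_indicator_iff)
  have "((\<lambda>v. \<integral>x. \<bar>indicator A (x - v) - indicator A x :: real\<bar> \<partial>lborel) \<longlongrightarrow> 0) (at 0)"
  proof (rule tendsto_0_if_approximable)
    fix e :: real assume e: "e > 0"
    obtain U where U: "open U" "A \<subseteq> U" "emeasure lborel (U - A) < ennreal (e / 2)"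
      using outer_regular_lborel[of A "e / 2"] e by auto
    have [measurable]: "U \<in> sets borel" using U by auto
    have "emeasure lborel U = emeasure lborel (U - A) + emeasure lborel A"
      using U by (subst plus_emeasure) (auto intro!: arg_cong[where f="emeasure lborel"])
    also have "\<dots> < \<infinity>" using U(3) base by (auto simp: less_top[symmetric] top_unique)
    finally have fU: "emeasure lborel U < \<infinity>" .
    then have iU: "integrable lborel (indicator U :: 'a \<Rightarrow> real)" by (simp add: integrable_indicator_iff)
    have "(\<integral>x. \<bar>indicator A x - indicator U x\<bar> \<partial>lborel) = (\<integral>x. indicator (U - A) x \<partial>lborel :: real)"
      using U(2) by (intro Bochner_Integration.integral_cong) (auto simp: indicator_def)
    also have "\<dots> = measure lborel (U - A)" by simp
    also have "\<dots> \<le> e / 2"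
      using U(3) e unfolding measure_def by (intro enn2real_leI) auto
    finally have "2 * (\<integral>x. \<bar>indicator A x - indicator U x\<bar> \<partial>lborel) \<le> e" by simp
    then have "(\<integral>x. \<bar>indicator A (x - v) - indicator A x :: real\<bar> \<partial>lborel)
        \<le> (\<integral>x. \<bar>indicator U (x - v) - indicator U x :: real\<bar> \<partial>lborel) + e" for v
      using translation_continuous_perturb[OF iA iU, of v] by linarith
    then show "\<exists>G. (G \<longlongrightarrow> 0) (at 0) \<and>
        (\<forall>v. (\<integral>x. \<bar>indicator A (x - v) - indicator A x :: real\<bar> \<partial>lborel) \<le> G v + e)"
      using translation_continuous_indicator_open[OF U(1) fU] by blast
  qed simp
  moreover have "(\<integral>x. \<bar>indicator A (x - v) *\<^sub>R c - indicator A x *\<^sub>R c\<bar> \<partial>lborel)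
      = (\<integral>x. \<bar>indicator A (x - v) - indicator A x :: real\<bar> \<partial>lborel) * \<bar>c\<bar>" for v
    unfolding integral_mult_left_zero[symmetric]
    by (intro Bochner_Integration.integral_cong refl) (simp flip: left_diff_distrib abs_mult)
  ultimately show ?case
    using tendsto_mult_left_zero[of _ _ "\<bar>c\<bar>"] by (simp only:)
next
  case (add f g)
  note tr = lborel_integrable_translate
  have "(\<integral>x. \<bar>f (x - v) + g (x - v) - (f x + g x)\<bar> \<partial>lborel)
     \<le> (\<integral>x. \<bar>f (x - v) - f x\<bar> \<partial>lborel) + (\<integral>x. \<bar>g (x - v) - g x\<bar> \<partial>lborel)" for v
  proof -
    have i: "integrable lborel (\<lambda>x. f (x - v))" "integrable lborel (\<lambda>x. g (x - v))"
      using add tr by auto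
    have "(\<integral>x. \<bar>f (x - v) + g (x - v) - (f x + g x)\<bar> \<partial>lborel)
       \<le> (\<integral>x. \<bar>f (x - v) - f x\<bar> + \<bar>g (x - v) - g x\<bar> \<partial>lborel)"
      using i add by (intro integral_mono) auto
    then show ?thesis using i add by simp
  qed
  note le = this
  have sum0: "((\<lambda>v. (\<integral>x. \<bar>f (x - v) - f x\<bar> \<partial>lborel) + (\<integral>x. \<bar>g (x - v) - g x\<bar> \<partial>lborel)) \<longlongrightarrow> 0) (at 0)"
    using tendsto_add[OF add.IH] by simp
  show ?case
    by (rule tendsto_sandwich[OF always_eventually always_eventually tendsto_const sum0])
      (use le in simp_all)
next
  case (lim f s)
  have s: "integrable lborel (s i)" for i by (rule lim.hyps)
  have sf: "(\<lambda>i. s i x) \<longlonglongrightarrow> f x" for x using lim.hyps by simp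
  have bd: "\<bar>s i x\<bar> \<le> 2 * \<bar>f x\<bar>" for i x using lim.hyps by simp
  have f: "integrable lborel f" by (rule lim.hyps)
  show ?case
  proof (rule tendsto_0_if_approximable)
    fix e :: real assume e: "e > 0"
    have "(\<lambda>i. \<integral>x. \<bar>f x - s i x\<bar> \<partial>lborel) \<longlonglongrightarrow> (\<integral>x. 0 \<partial>(lborel :: 'a measure))"
    proof (rule integral_dominated_convergence[where w="\<lambda>x. 3 * \<bar>f x\<bar>"])
      show "AE x in lborel. (\<lambda>i. \<bar>f x - s i x\<bar>) \<longlonglongrightarrow> 0"
      proof (intro AE_I2)
        fix x :: 'a
        have "(\<lambda>i. \<bar>f x - s i x\<bar>) \<longlonglongrightarrow> \<bar>f x - f x\<bar>"
          by (intro tendsto_intros sf)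
        then show "(\<lambda>i. \<bar>f x - s i x\<bar>) \<longlonglongrightarrow> 0" by simp
      qed
      show "AE x in lborel. norm \<bar>f x - s i x\<bar> \<le> 3 * \<bar>f x\<bar>" for i
      proof (intro AE_I2)
        fix x :: 'a
        show "norm \<bar>f x - s i x\<bar> \<le> 3 * \<bar>f x\<bar>" using bd[of i x] by auto
      qed
      show "(\<lambda>x. \<bar>f x - s i x\<bar>) \<in> borel_measurable lborel" for i
        using s f by auto
    qed (use f in auto)
    then have "eventually (\<lambda>i. (\<integral>x. \<bar>f x - s i x\<bar> \<partial>lborel) < e / 2) sequentially"
      using e by (intro order_tendstoD(2)) auto
    then obtain i where "(\<integral>x. \<bar>f x - s i x\<bar> \<partial>lborel) < e / 2"
      by (meson eventually_sequentially order_refl)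
    then have "(\<integral>x. \<bar>f (x - v) - f x\<bar> \<partial>lborel) \<le> (\<integral>x. \<bar>s i (x - v) - s i x\<bar> \<partial>lborel) + e" for v
      using translation_continuous_perturb[OF f s, of v i] by linarith
    then show "\<exists>G. (G \<longlongrightarrow> 0) (at 0) \<and> (\<forall>v. (\<integral>x. \<bar>f (x - v) - f x\<bar> \<partial>lborel) \<le> G v + e)"
      using lim.IH[of i] by blast
  qed simp
qed

section \<open>The Fourier transform of integrable functions\<close>

definition fourier :: "('a::euclidean_space \<Rightarrow> real) \<Rightarrow> 'a \<Rightarrow> complex" where
  "fourier f k = (\<integral>x. of_real (f x) * cis (k \<bullet> x) \<partial>lborel)"

lemma borel_measurable_cis [measurable]: "cis \<in> borel_measurable borel"
  by (intro borel_measurable_continuous_onI continuous_intros)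

lemma integrable_fourier:
  fixes f :: "'a::euclidean_space \<Rightarrow> real"
  assumes "integrable lborel f"
  shows "integrable lborel (\<lambda>x. of_real (f x) * cis (k \<bullet> x))"
proof -
  have [measurable]: "f \<in> borel_measurable borel" using assms by auto
  show ?thesis
    by (rule Bochner_Integration.integrable_bound[OF assms]) (auto simp: norm_mult)
qed

lemma fourier_0: "fourier f 0 = of_real (\<integral>x. f x \<partial>lborel)"
  by (simp add: fourier_def)

lemma fourier_add:
  "integrable lborel f \<Longrightarrow> integrable lborel g \<Longrightarrow>
    fourier (\<lambda>x. f x + g x) k = fourier f k + fourier g k"
  by (simp add: fourier_def ring_distribs integrable_fourier)

lemma fourier_diff:
  "integrable lborel f \<Longrightarrow> integrable lborel g \<Longrightarrow>
    fourier (\<lambda>x. f x - g x) k = fourier f k - fourier g k"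
  by (simp add: fourier_def ring_distribs integrable_fourier)

lemma fourier_cmult: "fourier (\<lambda>x. c * f x) k = of_real c * fourier f k"
  by (simp add: fourier_def mult.assoc)

lemma fourier_sum:
  assumes "\<And>i. i \<in> I \<Longrightarrow> integrable lborel (f i)"
  shows "fourier (\<lambda>x. \<Sum>i\<in>I. f i x) k = (\<Sum>i\<in>I. fourier (f i) k)"
  using assms by (simp add: fourier_def sum_distrib_right integrable_fourier)

lemma norm_fourier_le:
  assumes "integrable lborel f"
  shows "cmod (fourier f k) \<le> (\<integral>x. \<bar>f x\<bar> \<partial>lborel)"
proof -
  have "cmod (fourier f k) \<le> (\<integral>x. cmod (of_real (f x) * cis (k \<bullet> x)) \<partial>lborel)"
    unfolding fourier_def by (rule integral_norm_bound)
  then show ?thesis by (simp add: norm_mult)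
qed

lemma fourier_tendsto:
  fixes g :: "nat \<Rightarrow> 'a::euclidean_space \<Rightarrow> real"
  assumes "\<And>i. integrable lborel (g i)" "integrable lborel h"
    and "AE x in lborel. (\<lambda>i. g i x) \<longlonglongrightarrow> f x" "\<And>i. AE x in lborel. \<bar>g i x\<bar> \<le> h x"
    and [measurable]: "f \<in> borel_measurable borel"
  shows "(\<lambda>i. fourier (g i) k) \<longlonglongrightarrow> fourier f k"
  unfolding fourier_def
proof (rule integral_dominated_convergence[where w=h])
  show "AE x in lborel. (\<lambda>i. of_real (g i x) * cis (k \<bullet> x)) \<longlonglongrightarrow> of_real (f x) * cis (k \<bullet> x)"
    using assms(3) by eventually_elim (intro tendsto_intros)
  show "AE x in lborel. norm (of_real (g i x) * cis (k \<bullet> x)) \<le> h x" for i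
    using assms(4)[of i] by eventually_elim (simp add: norm_mult)
  show "(\<lambda>x. of_real (g i x) * cis (k \<bullet> x)) \<in> borel_measurable lborel" for i
    using integrable_fourier[OF assms(1)] by auto
qed (use assms in auto)

lemma continuous_on_fourier:
  fixes f :: "'a::euclidean_space \<Rightarrow> real"
  assumes f: "integrable lborel f"
  shows "continuous_on UNIV (fourier f)"
  unfolding continuous_on_sequentially
proof (intro allI ballI impI, elim conjE)
  fix X :: "nat \<Rightarrow> 'a" and k assume X: "X \<longlonglongrightarrow> k"
  have "(\<lambda>i. fourier f (X i)) \<longlonglongrightarrow> fourier f k"
    unfolding fourier_def
  proof (rule integral_dominated_convergence[where w="\<lambda>x. \<bar>f x\<bar>"])
    show "AE x in lborel. (\<lambda>i. of_real (f x) * cis (X i \<bullet> x)) \<longlonglongrightarrow> of_real (f x) * cis (k \<bullet> x)"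
      by (intro AE_I2 tendsto_intros X)
    show "(\<lambda>x. of_real (f x) * cis (X i \<bullet> x)) \<in> borel_measurable lborel" for i
      using integrable_fourier[OF f] by auto
    show "(\<lambda>x. of_real (f x) * cis (k \<bullet> x)) \<in> borel_measurable lborel"
      using integrable_fourier[OF f] by auto
  qed (use f in \<open>auto simp: norm_mult\<close>)
  then show "(fourier f \<circ> X) \<longlonglongrightarrow> fourier f k" by (simp add: o_def)
qed

text \<open>
  With \<open>v = \<pi>k / |k|\<^sup>2\<close> one has \<open>k \<bullet> v = \<pi>\<close>, so translating by \<open>v\<close> flips the sign of the
  character.  Hence twice the transform of \<open>f\<close> is the transform of a difference of translates, and
  \<open>v \<rightarrow> 0\<close> as \<open>k \<rightarrow> \<infinity>\<close>.
\<close>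

lemma fourier_half_period:
  fixes f :: "'a::euclidean_space \<Rightarrow> real"
  assumes f: "integrable lborel f" and "k \<noteq> 0"
  shows "2 * cmod (fourier f k) \<le> (\<integral>x. \<bar>f (x - (pi / (norm k)\<^sup>2) *\<^sub>R k) - f x\<bar> \<partial>lborel)"
proof -
  define v where "v = (pi / (norm k)\<^sup>2) *\<^sub>R k"
  have kv: "k \<bullet> v = pi"
    using \<open>k \<noteq> 0\<close> by (simp add: v_def dot_square_norm)
  have fv: "integrable lborel (\<lambda>x. f (x - v))" by (rule lborel_integrable_translate[OF f])
  have "fourier f k = (\<integral>x. of_real (f (x - v)) * cis (k \<bullet> (x - v)) \<partial>lborel)"
    unfolding fourier_def by (rule lborel_integral_translate[symmetric, OF integrable_fourier[OF f]])
  also have "\<dots> = - fourier (\<lambda>x. f (x - v)) k"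
    by (simp add: fourier_def inner_diff_right kv cis_divide[symmetric] flip: integral_minus)
  finally have "2 * fourier f k = - fourier (\<lambda>x. f (x - v) - f x) k"
    by (simp add: fourier_diff[OF fv f])
  then have "2 * cmod (fourier f k) = cmod (fourier (\<lambda>x. f (x - v) - f x) k)"
    by (metis norm_minus_cancel norm_mult norm_numeral)
  also have "\<dots> \<le> (\<integral>x. \<bar>f (x - v) - f x\<bar> \<partial>lborel)"
    using f fv by (intro norm_fourier_le) auto
  finally show ?thesis by (simp add: v_def)
qed

theorem Riemann_Lebesgue:
  fixes f :: "'a::euclidean_space \<Rightarrow> real"
  assumes f: "integrable lborel f"
  shows "(fourier f \<longlongrightarrow> 0) at_infinity"
proof (rule Lim_null_comparison)
  let ?v = "\<lambda>k::'a. (pi / (norm k)\<^sup>2) *\<^sub>R k"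
  have ev: "eventually (\<lambda>k::'a. k \<noteq> 0) at_infinity"
    unfolding eventually_at_infinity by (intro exI[of _ 1]) auto
  have "((\<lambda>k::'a. pi * inverse (norm k)) \<longlongrightarrow> pi * 0) at_infinity"
    by (intro tendsto_intros tendsto_inverse_0_at_top filterlim_norm_at_top)
  then have lim: "((\<lambda>k::'a. pi * inverse (norm k)) \<longlongrightarrow> 0) at_infinity" by simp
  have "eventually (\<lambda>k::'a. norm (?v k) \<le> pi * inverse (norm k)) at_infinity"
    using ev
  proof eventually_elim
    case (elim k)
    have "norm (?v k) = pi / (norm k)\<^sup>2 * norm k" by simp
    also have "\<dots> = pi * inverse (norm k)"
      using elim by (simp add: power2_eq_square divide_inverse)
    finally show ?case by simp
  qed
  then have "(?v \<longlongrightarrow> 0) at_infinity"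
    using lim by (rule Lim_null_comparison)
  moreover have "eventually (\<lambda>k::'a. ?v k \<noteq> 0) at_infinity"
    using ev by eventually_elim simp
  ultimately have "filterlim ?v (at 0) at_infinity"
    by (simp add: filterlim_at)
  then have "((\<lambda>k. \<integral>x. \<bar>f (x - ?v k) - f x\<bar> \<partial>lborel) \<longlongrightarrow> 0) at_infinity"
    by (rule filterlim_compose[OF translation_continuous_L1[OF f]])
  then show "((\<lambda>k. (\<integral>x. \<bar>f (x - ?v k) - f x\<bar> \<partial>lborel) / 2) \<longlongrightarrow> 0) at_infinity"
    by (rule tendsto_divide_zero)
  show "eventually (\<lambda>k. cmod (fourier f k) \<le> (\<integral>x. \<bar>f (x - ?v k) - f x\<bar> \<partial>lborel) / 2) at_infinity"
    using ev by eventually_elim (use fourier_half_period[OF f] in force)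
qed

text \<open>
  If equality held, then for some phase \<open>t\<close> the non-negative function \<open>g x (1 - cos (k \<bullet> x - t))\<close>
  would have integral \<open>0\<close>.  So \<open>g\<close> would vanish off the countable union of hyperplanes
  \<open>k \<bullet> x \<in> t + 2\<pi>\<int>\<close>, which is a null set.
\<close>

lemma norm_fourier_less:
  fixes g :: "'a::euclidean_space \<Rightarrow> real"
  assumes g: "integrable lborel g" and nonneg: "AE x in lborel. g x \<ge> 0"
    and pos: "(\<integral>x. g x \<partial>lborel) > 0" and "k \<noteq> 0"
  shows "cmod (fourier g k) < (\<integral>x. g x \<partial>lborel)"
proof (rule ccontr)
  assume contra: "\<not> ?thesis"
  have [measurable]: "g \<in> borel_measurable borel" using g by auto
  have "(\<integral>x. \<bar>g x\<bar> \<partial>lborel) = (\<integral>x. g x \<partial>lborel)"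
    using nonneg g by (intro integral_cong_AE) auto
  with contra norm_fourier_le[OF g, of k] have eq: "cmod (fourier g k) = (\<integral>x. g x \<partial>lborel)" by simp
  define t where "t = Arg (fourier g k)"
  have "fourier g k = of_real (\<integral>x. g x \<partial>lborel) * cis t"
    using rcis_cmod_Arg[of "fourier g k"] by (simp add: rcis_def eq t_def)
  then have "of_real (\<integral>x. g x \<partial>lborel) = fourier g k * cis (- t)"
    by (simp add: mult.assoc cis_mult)
  also have "\<dots> = (\<integral>x. of_real (g x) * cis (k \<bullet> x - t) \<partial>lborel)"
    unfolding fourier_def
    by (subst integral_mult_left_zero[symmetric]) (simp add: mult.assoc cis_mult)
  finally have *: "of_real (\<integral>x. g x \<partial>lborel) = (\<integral>x. of_real (g x) * cis (k \<bullet> x - t) \<partial>lborel)" .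
  have i: "integrable lborel (\<lambda>x. of_real (g x) * cis (k \<bullet> x - t))"
    by (rule Bochner_Integration.integrable_bound[OF g]) (auto simp: norm_mult)
  have ic: "integrable lborel (\<lambda>x. g x * cos (k \<bullet> x - t))"
    using integrable_Re[OF i] by simp
  have "(\<integral>x. g x \<partial>lborel) = (\<integral>x. g x * cos (k \<bullet> x - t) \<partial>lborel)"
    using arg_cong[OF *, of Re] integral_Re[OF i] by simp
  then have "(\<integral>x. g x * (1 - cos (k \<bullet> x - t)) \<partial>lborel) = 0"
    using g ic by (simp add: ring_distribs)
  moreover have "integrable lborel (\<lambda>x. g x * (1 - cos (k \<bullet> x - t)))"
    using g ic by (simp add: ring_distribs)
  moreover have "AE x in lborel. g x * (1 - cos (k \<bullet> x - t)) \<ge> 0"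
    using nonneg by eventually_elim simp
  ultimately have "AE x in lborel. g x * (1 - cos (k \<bullet> x - t)) = 0"
    using integral_nonneg_eq_0_iff_AE by blast
  moreover have "AE x in lborel. cos (k \<bullet> x - t) \<noteq> 1"
  proof -
    have "AE x in lborel. k \<bullet> x \<noteq> t + 2 * pi * of_int n" for n
    proof -
      have "{x. k \<bullet> x = t + 2 * pi * of_int n} \<in> null_sets lebesgue"
        using negligible_hyperplane[of k] \<open>k \<noteq> 0\<close> by (simp add: negligible_iff_null_sets)
      moreover have "{x. k \<bullet> x = t + 2 * pi * of_int n} \<in> sets lborel"
        using closed_hyperplane[of k] by (metis borel_closed sets_lborel)
      ultimately have "{x. k \<bullet> x = t + 2 * pi * of_int n} \<in> null_sets lborel"
        using null_sets_completion_iff by blast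
      then show ?thesis
        by (rule AE_not_in[THEN eventually_mono]) simp
    qed
    then have "AE x in lborel. \<forall>n::int. k \<bullet> x \<noteq> t + 2 * pi * of_int n"
      by (simp add: AE_all_countable)
    then show ?thesis
    proof eventually_elim
      case (elim x)
      show ?case
      proof
        assume "cos (k \<bullet> x - t) = 1"
        then obtain n :: int where "k \<bullet> x - t = of_int n * 2 * pi"
          unfolding cos_one_2pi_int by blast
        with elim[rule_format, of n] show False by (simp add: algebra_simps)
      qed
    qed
  qed
  ultimately have "AE x in lborel. g x = 0"
    by eventually_elim simp
  then have "(\<integral>x. g x \<partial>lborel) = 0"
    by (subst integral_cong_AE[of _ _ "\<lambda>_. 0"]) auto
  with pos show False by simp
qed

section \<open>Uniqueness of the Fourier transform\<close>

definition gauss :: "'a::euclidean_space \<Rightarrow> real" where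
  "gauss z = (\<Prod>b\<in>Basis. std_normal_density (z \<bullet> b))"

lemma gauss_nonneg: "gauss z \<ge> 0"
  by (auto simp: gauss_def intro!: prod_nonneg)

lemma borel_measurable_gauss [measurable]: "gauss \<in> borel_measurable borel"
  unfolding gauss_def[abs_def] by measurable

lemma nn_integral_gauss: "(\<integral>\<^sup>+z. ennreal (gauss z) \<partial>(lborel :: 'a::euclidean_space measure)) = 1"
proof -
  have 1: "(\<integral>\<^sup>+x. ennreal (std_normal_density x) \<partial>lborel) = 1"
    using integrable_normal_density[of 1 0] integral_normal_density[of 1 0]
    by (subst nn_integral_eq_integral) auto
  have "(\<integral>\<^sup>+z. ennreal (gauss z) \<partial>(lborel :: 'a measure))
     = (\<integral>\<^sup>+z. (\<Prod>b\<in>Basis. ennreal (std_normal_density (z \<bullet> b))) \<partial>(lborel :: 'a measure))"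
    by (simp add: gauss_def prod_ennreal)
  also have "\<dots> = (\<Prod>b\<in>(Basis::'a set). \<integral>\<^sup>+x. ennreal (std_normal_density x) \<partial>lborel)"
    by (rule nn_integral_lborel_prod) auto
  finally show ?thesis by (simp add: 1)
qed

lemma integrable_gauss: "integrable lborel gauss"
  by (rule integrableI_nn_integral_finite[where x=1]) (auto simp: nn_integral_gauss gauss_nonneg)

lemma integral_gauss: "(\<integral>z. gauss z \<partial>(lborel :: 'a::euclidean_space measure)) = 1"
  by (rule integral_eq_nn_integral[THEN trans]) (auto simp: gauss_nonneg nn_integral_gauss)

lemma std_normal_density_fourier:
  "(\<integral>s. of_real (std_normal_density s) * cis (t * s) \<partial>lborel) = of_real (exp (- (t\<^sup>2) / 2))"
proof -
  have "(\<integral>s. of_real (std_normal_density s) * cis (t * s) \<partial>lborel) = char std_normal_distribution t"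
    unfolding char_def by (subst integral_density) (auto simp: cis_conv_exp scaleR_conv_of_real)
  then show ?thesis by (simp add: char_std_normal_distribution)
qed

lemma lborel_integral_prod:
  fixes h :: "'a::euclidean_space \<Rightarrow> real \<Rightarrow> complex"
  assumes "\<And>b. b \<in> Basis \<Longrightarrow> integrable lborel (h b)"
  shows "(\<integral>z. (\<Prod>b\<in>Basis. h b (z \<bullet> b)) \<partial>lborel) = (\<Prod>b\<in>Basis. \<integral>s. h b s \<partial>lborel)"
proof -
  interpret product_sigma_finite "\<lambda>_::'a. lborel :: real measure" by standard
  have [measurable]: "h b \<in> borel_measurable borel" if "b \<in> Basis" for b
    using borel_measurable_integrable[OF assms[OF that]] by simp
  have "(\<integral>z. (\<Prod>b\<in>Basis. h b (z \<bullet> b)) \<partial>lborel)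
      = (\<integral>f. (\<Prod>b\<in>Basis. h b ((\<Sum>j\<in>Basis. f j *\<^sub>R j) \<bullet> b)) \<partial>(\<Pi>\<^sub>M b\<in>Basis. lborel))"
    by (subst lborel_eq, subst integral_distr) simp_all
  also have "\<dots> = (\<integral>f. (\<Prod>b\<in>Basis. h b (f b)) \<partial>(\<Pi>\<^sub>M b\<in>Basis. lborel))"
    by (intro Bochner_Integration.integral_cong prod.cong refl) simp
  also have "\<dots> = (\<Prod>b\<in>Basis. \<integral>s. h b s \<partial>lborel)"
    by (rule product_integral_prod) (use assms in auto)
  finally show ?thesis .
qed

text \<open>
  The Gaussian is, up to a constant, its own transform; this reduces to the characteristic function
  of the one-dimensional standard normal distribution.
\<close>

lemma fourier_gauss:
  fixes k :: "'a::euclidean_space"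
  shows "fourier gauss k = of_real (sqrt (2 * pi) ^ DIM('a) * gauss k)"
proof -
  have cis_prod: "cis (k \<bullet> z) = (\<Prod>b\<in>Basis. cis ((k \<bullet> b) * (z \<bullet> b)))" for z
    by (subst euclidean_inner) (simp add: cis_conv_exp sum_distrib_left exp_sum)
  have i: "integrable lborel (\<lambda>s. of_real (std_normal_density s) * cis (t * s))" for t
    using integrable_fourier[OF integrable_normal_density[of 1 0], of t] by simp
  have "fourier gauss k = (\<integral>z. (\<Prod>b\<in>Basis. of_real (std_normal_density (z \<bullet> b)) * cis ((k \<bullet> b) * (z \<bullet> b))) \<partial>lborel)"
    by (simp add: fourier_def gauss_def cis_prod prod.distrib)
  also have "\<dots> = (\<Prod>b\<in>Basis. of_real (exp (- ((k \<bullet> b)\<^sup>2) / 2)))"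
    by (subst lborel_integral_prod[where h="\<lambda>b s. of_real (std_normal_density s) * cis ((k \<bullet> b) * s)"])
      (simp_all add: std_normal_density_fourier i)
  also have "\<dots> = of_real (\<Prod>b\<in>Basis. sqrt (2 * pi) * std_normal_density (k \<bullet> b))"
    by (simp add: std_normal_density_def)
  finally show ?thesis by (simp add: gauss_def prod.distrib)
qed

text \<open>
  Fubini for \<open>f x * g k * cis (x \<bullet> k)\<close>.  Taken with \<open>g\<close> the Gaussian, it turns an average of \<open>f\<close>
  against the Gaussian into an average of the transform of \<open>f\<close>.
\<close>

lemma fourier_adjoint:
  fixes f g :: "'a::euclidean_space \<Rightarrow> real"
  assumes f: "integrable lborel f" and g: "integrable lborel g"
  shows "(\<integral>x. of_real (f x) * fourier g x \<partial>lborel) = (\<integral>k. of_real (g k) * fourier f k \<partial>lborel)"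
proof -
  have [measurable]: "f \<in> borel_measurable borel" "g \<in> borel_measurable borel" using f g by auto
  have "integrable (lborel \<Otimes>\<^sub>M lborel) (\<lambda>(x, k). of_real (f x) * (of_real (g k) * cis (x \<bullet> k)))"
  proof (rule lborel_pair.Fubini_integrable)
    show "integrable lborel (\<lambda>x. \<integral>k. norm (case (x, k) of (x, k) \<Rightarrow> of_real (f x) * (of_real (g k) * cis (x \<bullet> k))) \<partial>lborel)"
      using f by (simp add: norm_mult)
    show "AE x in lborel. integrable lborel (\<lambda>k. case (x, k) of (x, k) \<Rightarrow> of_real (f x) * (of_real (g k) * cis (x \<bullet> k)))"
      using integrable_fourier[OF g] by simp
  qed simp
  then have swap: "(\<integral>k. \<integral>x. of_real (f x) * (of_real (g k) * cis (x \<bullet> k)) \<partial>lborel \<partial>lborel)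
      = (\<integral>x. \<integral>k. of_real (f x) * (of_real (g k) * cis (x \<bullet> k)) \<partial>lborel \<partial>lborel)"
    by (rule lborel_pair.Fubini_integral)
  have "(\<integral>x. of_real (f x) * (of_real (g k) * cis (x \<bullet> k)) \<partial>lborel) = of_real (g k) * fourier f k" for k
    unfolding fourier_def integral_mult_right_zero[symmetric]
    by (intro Bochner_Integration.integral_cong refl) (simp add: inner_commute mult.left_commute)
  moreover have "(\<integral>k. of_real (f x) * (of_real (g k) * cis (x \<bullet> k)) \<partial>lborel) = of_real (f x) * fourier g x" for x
    by (simp only: fourier_def integral_mult_right_zero)
  ultimately show ?thesis using swap by (simp only:)
qed

lemma fourier_affine_eq_0:
  fixes f :: "'a::euclidean_space \<Rightarrow> real"
  assumes f: "integrable lborel f" and zero: "\<And>k. fourier f k = 0" and c: "c \<noteq> 0"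
  shows "fourier (\<lambda>z. f (x + c *\<^sub>R z)) k = 0"
proof -
  have eq: "of_real (f y) * cis ((k /\<^sub>R c) \<bullet> (y - x))
      = of_real (f y) * cis ((k /\<^sub>R c) \<bullet> y) * cis (- ((k /\<^sub>R c) \<bullet> x))" for y
    by (simp add: mult.assoc cis_mult inner_diff_right)
  have i: "integrable lborel (\<lambda>y. of_real (f y) * cis ((k /\<^sub>R c) \<bullet> (y - x)))"
    unfolding eq by (intro integrable_mult_left integrable_fourier f)
  have "(\<integral>y. of_real (f y) * cis ((k /\<^sub>R c) \<bullet> (y - x)) \<partial>lborel) = 0"
    unfolding eq integral_mult_left_zero using zero[of "k /\<^sub>R c"] by (simp only: fourier_def mult_zero_left)
  with lborel_integral_affine[OF i c, of x] show ?thesis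
    using c by (simp add: fourier_def mult.assoc[symmetric])
qed

lemma integrable_mult_gauss:
  fixes f :: "'a::euclidean_space \<Rightarrow> real"
  assumes f: "integrable lborel f"
  shows "integrable lborel (\<lambda>z. f z * gauss z)"
proof -
  have [measurable]: "f \<in> borel_measurable borel" using f by auto
  let ?C = "sqrt (2 * pi) ^ DIM('a)"
  have C: "?C > 0" by simp
  \<comment> \<open>The Gaussian is bounded, being a multiple of the transform of a probability density.\<close>
  have "?C * gauss z \<le> 1" for z :: 'a
    using norm_fourier_le[OF integrable_gauss, of z] C
    by (simp add: fourier_gauss norm_mult gauss_nonneg integral_gauss del: of_real_power of_real_mult)
  then have b: "gauss z \<le> 1 / ?C" for z :: 'a
    using C by (simp add: field_simps)
  show ?thesis
  proof (rule Bochner_Integration.integrable_bound)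
    show "integrable lborel (\<lambda>z. f z * (1 / ?C))" using f by simp
    show "AE z in lborel. norm (f z * gauss z) \<le> norm (f z * (1 / ?C))"
    proof (intro AE_I2)
      fix z :: 'a
      have "\<bar>f z\<bar> * gauss z \<le> \<bar>f z\<bar> * (1 / ?C)"
        using b by (rule mult_left_mono) simp
      then show "norm (f z * gauss z) \<le> norm (f z * (1 / ?C))"
        by (simp add: abs_mult gauss_nonneg)
    qed
  qed simp
qed

text \<open>
  A function with vanishing transform has vanishing Gaussian averages at every point and every
  scale \<open>c\<close>, since an affine substitution changes the transform only by
  rescaling and multiplication by a nowhere vanishing function.
\<close>

lemma gauss_smoothing_eq_0:
  fixes f :: "'a::euclidean_space \<Rightarrow> real"
  assumes f: "integrable lborel f" and zero: "\<And>k. fourier f k = 0" and c: "c \<noteq> 0"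
  shows "(\<integral>z. f (x + c *\<^sub>R z) * gauss z \<partial>lborel) = 0"
proof -
  let ?f = "\<lambda>z. f (x + c *\<^sub>R z)" and ?C = "sqrt (2 * pi) ^ DIM('a)"
  have i: "integrable lborel ?f" by (rule lborel_integrable_affine[OF f c])
  have "of_real (?C * (\<integral>z. ?f z * gauss z \<partial>lborel))
      = (\<integral>z. of_real (?f z) * fourier gauss z \<partial>lborel)"
    unfolding integral_mult_right_zero[symmetric] integral_complex_of_real[symmetric] fourier_gauss
    by (intro Bochner_Integration.integral_cong refl) simp
  also have "\<dots> = 0"
    unfolding fourier_adjoint[OF i integrable_gauss] fourier_affine_eq_0[OF f zero c] by simp
  finally show ?thesis by simp
qed

text \<open>
  The Gaussian averages of \<open>f\<close> at scale \<open>c\<close> vanish, yet they converge to \<open>f\<close> in \<open>L\<^sup>1\<close> as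
  \<open>c \<rightarrow> 0\<close>: the distance is at most the Gaussian average of \<open>\<parallel>f(\<cdot> + c z) - f\<parallel>\<^sub>1\<close> over \<open>z\<close>, which tends to
  \<open>0\<close> by continuity of translation and dominated convergence.
\<close>

theorem fourier_eq_0_imp_AE_eq_0:
  fixes f :: "'a::euclidean_space \<Rightarrow> real"
  assumes f: "integrable lborel f" and zero: "\<And>k. fourier f k = 0"
  shows "AE x in lborel. f x = 0"
proof -
  have [measurable]: "f \<in> borel_measurable borel" using f by auto
  define T where "T v = (\<integral>x. \<bar>f (x - v) - f x\<bar> \<partial>lborel)" for v
  have [measurable]: "T \<in> borel_measurable borel"
    unfolding T_def[abs_def] by measurable
  have Tnn: "T v \<ge> 0" for v unfolding T_def by simp
  have iT: "integrable lborel (\<lambda>x. \<bar>f (x - v) - f x\<bar>)" for v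
    using f lborel_integrable_translate[OF f, of v] by auto
  define I where "I = (\<integral>x. \<bar>f x\<bar> \<partial>lborel)"
  have T_le: "T v \<le> 2 * I" for v
    using translation_continuous_perturb[OF f, of "\<lambda>_. 0" v] by (simp add: T_def I_def)
  have iG: "integrable lborel (\<lambda>z. gauss z * T (- c *\<^sub>R z))" for c
  proof (rule Bochner_Integration.integrable_bound)
    show "integrable lborel (\<lambda>z::'a. gauss z * (2 * I))" using integrable_gauss by auto
    have "I \<ge> 0" by (simp add: I_def)
    then show "AE z in lborel. norm (gauss z * T (- c *\<^sub>R z)) \<le> norm (gauss z * (2 * I))"
      using T_le Tnn gauss_nonneg by (intro AE_I2) (auto simp: abs_mult intro!: mult_left_mono)
  qed simp
  have bound: "I \<le> (\<integral>z. gauss z * T (- c *\<^sub>R z) \<partial>lborel)" if c: "c \<noteq> 0" for c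
  proof -
    have pw: "ennreal \<bar>f x\<bar> \<le> (\<integral>\<^sup>+z. ennreal (\<bar>f (x + c *\<^sub>R z) - f x\<bar> * gauss z) \<partial>lborel)" for x
    proof -
      have i1: "integrable lborel (\<lambda>z. f (x + c *\<^sub>R z) * gauss z)"
        by (intro integrable_mult_gauss lborel_integrable_affine f c)
      have i2: "integrable lborel (\<lambda>z. f x * gauss z)"
        using integrable_gauss by auto
      have "(\<integral>z. (f (x + c *\<^sub>R z) - f x) * gauss z \<partial>lborel) = - f x"
        unfolding left_diff_distrib Bochner_Integration.integral_diff[OF i1 i2]
        by (simp add: gauss_smoothing_eq_0[OF f zero c] integral_gauss)
      moreover have "integrable lborel (\<lambda>z. (f (x + c *\<^sub>R z) - f x) * gauss z)"
        unfolding left_diff_distrib using i1 i2 by (rule Bochner_Integration.integrable_diff)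
      ultimately have "ennreal (norm (- f x)) \<le> (\<integral>\<^sup>+z. ennreal (norm ((f (x + c *\<^sub>R z) - f x) * gauss z)) \<partial>lborel)"
        using integral_norm_bound_ennreal by metis
      then show ?thesis by (simp add: abs_mult gauss_nonneg)
    qed
    have "ennreal I = (\<integral>\<^sup>+x. ennreal \<bar>f x\<bar> \<partial>lborel)"
      unfolding I_def using f by (subst nn_integral_eq_integral) auto
    also have "\<dots> \<le> (\<integral>\<^sup>+x. (\<integral>\<^sup>+z. ennreal (\<bar>f (x + c *\<^sub>R z) - f x\<bar> * gauss z) \<partial>lborel) \<partial>lborel)"
      by (intro nn_integral_mono pw)
    also have "\<dots> = (\<integral>\<^sup>+z. (\<integral>\<^sup>+x. ennreal (\<bar>f (x + c *\<^sub>R z) - f x\<bar> * gauss z) \<partial>lborel) \<partial>lborel)"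
      by (rule lborel_pair.Fubini') measurable
    also have "\<dots> = (\<integral>\<^sup>+z. ennreal (gauss z * T (- c *\<^sub>R z)) \<partial>lborel)"
    proof (intro nn_integral_cong)
      fix z :: 'a
      have "(\<integral>\<^sup>+x. ennreal (\<bar>f (x + c *\<^sub>R z) - f x\<bar> * gauss z) \<partial>lborel)
          = ennreal (\<integral>x. \<bar>f (x + c *\<^sub>R z) - f x\<bar> * gauss z \<partial>lborel)"
        using iT[of "- c *\<^sub>R z"] by (intro nn_integral_eq_integral) (auto simp: gauss_nonneg)
      then show "(\<integral>\<^sup>+x. ennreal (\<bar>f (x + c *\<^sub>R z) - f x\<bar> * gauss z) \<partial>lborel)
          = ennreal (gauss z * T (- c *\<^sub>R z))"
        by (simp add: T_def mult.commute)
    qed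
    also have "\<dots> = ennreal (\<integral>z. gauss z * T (- c *\<^sub>R z) \<partial>lborel)"
      using iG[of c] by (intro nn_integral_eq_integral) (auto simp: gauss_nonneg Tnn)
    finally show ?thesis
      by (subst (asm) ennreal_le_iff) (auto simp: gauss_nonneg Tnn intro!: integral_nonneg)
  qed
  have "(\<lambda>n. \<integral>z. gauss z * T (- (inverse (real (Suc n))) *\<^sub>R z) \<partial>lborel) \<longlonglongrightarrow> (\<integral>z. 0 \<partial>(lborel :: 'a measure))"
  proof (rule integral_dominated_convergence[where w="\<lambda>z. gauss z * (2 * I)"])
    show "integrable lborel (\<lambda>z::'a. gauss z * (2 * I))" using integrable_gauss by auto
    show "AE z in lborel. norm (gauss z * T (- (inverse (real (Suc n))) *\<^sub>R z)) \<le> gauss z * (2 * I)" for n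
      using T_le Tnn gauss_nonneg
      by (intro AE_I2) (auto simp: abs_mult abs_of_nonneg[OF gauss_nonneg] intro!: mult_left_mono)
    show "AE z in lborel. (\<lambda>n. gauss z * T (- (inverse (real (Suc n))) *\<^sub>R z)) \<longlonglongrightarrow> 0"
    proof (intro AE_I2)
      fix z :: 'a
      have "(\<lambda>n. T (- (inverse (real (Suc n))) *\<^sub>R z)) \<longlonglongrightarrow> 0"
      proof (cases "z = 0")
        case True
        then show ?thesis by (simp add: T_def)
      next
        case False
        have "(\<lambda>n. - (inverse (real (Suc n))) *\<^sub>R z) \<longlonglongrightarrow> - 0 *\<^sub>R z"
          by (intro tendsto_intros LIMSEQ_inverse_real_of_nat)
        then have "filterlim (\<lambda>n. - (inverse (real (Suc n))) *\<^sub>R z) (at 0) sequentially"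
          using False by (simp add: filterlim_at)
        then show ?thesis
          unfolding T_def by (rule filterlim_compose[OF translation_continuous_L1[OF f]])
      qed
      from tendsto_mult_right_zero[OF this] show "(\<lambda>n. gauss z * T (- (inverse (real (Suc n))) *\<^sub>R z)) \<longlonglongrightarrow> 0" .
    qed
  qed simp_all
  then have "(\<lambda>n. \<integral>z. gauss z * T (- (inverse (real (Suc n))) *\<^sub>R z) \<partial>lborel) \<longlonglongrightarrow> 0" by simp
  then have "I \<le> 0"
    by (rule LIMSEQ_le_const) (use bound in auto)
  moreover have "I \<ge> 0" by (simp add: I_def)
  ultimately have "I = 0" by simp
  then have "AE x in lborel. \<bar>f x\<bar> = 0"
    unfolding I_def using f by (subst (asm) integral_nonneg_eq_0_iff_AE) auto
  then show ?thesis by simp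
qed

lemma fourier_inject_AE:
  fixes f g :: "'a::euclidean_space \<Rightarrow> real"
  assumes f: "integrable lborel f" and g: "integrable lborel g" and "\<And>k. fourier f k = fourier g k"
  shows "AE x in lborel. f x = g x"
proof -
  have "AE x in lborel. f x - g x = 0"
    using assms by (intro fourier_eq_0_imp_AE_eq_0) (auto simp: fourier_diff)
  then show ?thesis by simp
qed

section \<open>Convolution of integrable functions\<close>

lemma measurable_convolution_integrand:
  fixes f g :: "real^'d \<Rightarrow> real"
  assumes [measurable]: "f \<in> borel_measurable borel" "g \<in> borel_measurable borel"
  shows "(\<lambda>y. f y * g (x - y)) \<in> borel_measurable borel"
  by measurable

lemma convolution_lborel:
  fixes f g :: "real^'d \<Rightarrow> real"
  assumes "f \<in> borel_measurable borel" "g \<in> borel_measurable borel"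
  shows "convolution f g x = (\<integral>y. f y * g (x - y) \<partial>lborel)"
  unfolding convolution_def
  using measurable_convolution_integrand[OF assms] by (intro integral_completion) simp

lemma borel_measurable_convolution [measurable]:
  fixes f g :: "real^'d \<Rightarrow> real"
  assumes [measurable]: "f \<in> borel_measurable borel" "g \<in> borel_measurable borel"
  shows "convolution f g \<in> borel_measurable borel"
  unfolding convolution_lborel[OF assms, abs_def] by measurable

lemma integrable_convolution_kernel:
  fixes f g :: "real^'d \<Rightarrow> real"
  assumes f: "integrable lborel f" and g: "integrable lborel g"
  shows "integrable (lborel \<Otimes>\<^sub>M lborel) (\<lambda>(y, x). f y * g (x - y))"
proof (rule lborel_pair.Fubini_integrable)
  have [measurable]: "f \<in> borel_measurable borel" "g \<in> borel_measurable borel" using f g by auto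
  show "(\<lambda>(y, x). f y * g (x - y)) \<in> borel_measurable (lborel \<Otimes>\<^sub>M lborel)" by measurable
  have "(\<integral>x. norm (case (y, x) of (y, x) \<Rightarrow> f y * g (x - y)) \<partial>lborel)
      = \<bar>f y\<bar> * (\<integral>x. \<bar>g x\<bar> \<partial>lborel)" for y
    using lborel_integral_translate[of "\<lambda>x. \<bar>g x\<bar>" y] g by (simp add: abs_mult)
  then show "integrable lborel (\<lambda>y. \<integral>x. norm (case (y, x) of (y, x) \<Rightarrow> f y * g (x - y)) \<partial>lborel)"
    using f by simp
  show "AE y in lborel. integrable lborel (\<lambda>x. case (y, x) of (y, x) \<Rightarrow> f y * g (x - y))"
    using lborel_integrable_translate[OF g] by simp
qed

lemma integrable_convolution:
  fixes f g :: "real^'d \<Rightarrow> real"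
  assumes f: "integrable lborel f" and g: "integrable lborel g"
  shows "integrable lborel (convolution f g)"
proof -
  have "f \<in> borel_measurable borel" "g \<in> borel_measurable borel" using f g by auto
  from convolution_lborel[OF this, abs_def]
  show ?thesis
    using lborel_pair.integrable_snd[OF integrable_convolution_kernel[OF f g]] by simp
qed

lemma fourier_convolution:
  fixes f g :: "real^'d \<Rightarrow> real"
  assumes f: "integrable lborel f" and g: "integrable lborel g"
  shows "fourier (convolution f g) k = fourier f k * fourier g k"
proof -
  have m[measurable]: "f \<in> borel_measurable borel" "g \<in> borel_measurable borel" using f g by auto
  let ?F = "\<lambda>y x. of_real (f y * g (x - y)) * cis (k \<bullet> x)"
  have "integrable (lborel \<Otimes>\<^sub>M lborel) (\<lambda>(y, x). ?F y x)"
    by (rule Bochner_Integration.integrable_bound[OF integrable_convolution_kernel[OF f g]])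
      (auto simp: norm_mult)
  then have swap: "(\<integral>x. \<integral>y. ?F y x \<partial>lborel \<partial>lborel) = (\<integral>y. \<integral>x. ?F y x \<partial>lborel \<partial>lborel)"
    by (rule lborel_pair.Fubini_integral)
  have "(\<integral>y. ?F y x \<partial>lborel) = of_real (convolution f g x) * cis (k \<bullet> x)" for x
    by (simp only: convolution_lborel[OF m] integral_mult_left_zero integral_complex_of_real)
  then have "fourier (convolution f g) k = (\<integral>x. \<integral>y. ?F y x \<partial>lborel \<partial>lborel)"
    by (simp only: fourier_def)
  also note swap
  also have "(\<integral>x. ?F y x \<partial>lborel) = of_real (f y) * cis (k \<bullet> y) * fourier g k" for y
  proof -
    have "fourier g k = (\<integral>x. of_real (g (x - y)) * cis (k \<bullet> (x - y)) \<partial>lborel)"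
      unfolding fourier_def by (rule lborel_integral_translate[symmetric, OF integrable_fourier[OF g]])
    then have "of_real (f y) * cis (k \<bullet> y) * fourier g k
        = (\<integral>x. of_real (f y) * cis (k \<bullet> y) * (of_real (g (x - y)) * cis (k \<bullet> (x - y))) \<partial>lborel)"
      by (simp only: integral_mult_right_zero)
    also have "\<dots> = (\<integral>x. ?F y x \<partial>lborel)"
    proof (intro Bochner_Integration.integral_cong refl)
      fix x :: "real^'d"
      have "cis (k \<bullet> x) = cis (k \<bullet> y) * cis (k \<bullet> (x - y))"
        by (simp add: cis_mult inner_diff_right)
      then show "of_real (f y) * cis (k \<bullet> y) * (of_real (g (x - y)) * cis (k \<bullet> (x - y))) = ?F y x"
        by (simp only: of_real_mult mult_ac)
    qed
    finally show ?thesis ..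
  qed
  then have "(\<integral>y. \<integral>x. ?F y x \<partial>lborel \<partial>lborel) = fourier f k * fourier g k"
    by (simp only: fourier_def integral_mult_left_zero)
  finally show ?thesis .
qed

text \<open>
  Monotonicity holds only almost everywhere even if the inequalities between the factors hold at
  every point: where the larger integrand is not integrable, its integral has the default value
  \<open>0\<close>.
\<close>

lemma convolution_mono_AE:
  fixes f g f' g' :: "real^'d \<Rightarrow> real"
  assumes int: "integrable lborel f" "integrable lborel g" "integrable lborel f'" "integrable lborel g'"
    and f: "AE x in lborel. 0 \<le> f x \<and> f x \<le> f' x" and g: "AE x in lborel. 0 \<le> g x \<and> g x \<le> g' x"
  shows "AE x in lborel. 0 \<le> convolution f g x \<and> convolution f g x \<le> convolution f' g' x"
proof -
  have m: "f \<in> borel_measurable borel" "g \<in> borel_measurable borel"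
      "f' \<in> borel_measurable borel" "g' \<in> borel_measurable borel"
    using int by auto
  have "AE x in lborel. integrable lborel (\<lambda>y. f y * g (x - y))"
       "AE x in lborel. integrable lborel (\<lambda>y. f' y * g' (x - y))"
    using lborel_pair.AE_integrable_snd[OF integrable_convolution_kernel] int by auto
  then show ?thesis
  proof eventually_elim
    case (elim x)
    have "AE y in lborel. 0 \<le> g (x - y) \<and> g (x - y) \<le> g' (x - y)"
      using AE_lborel_affine[OF g, of "- 1" x] by simp
    with f have "AE y in lborel. 0 \<le> f y * g (x - y) \<and> f y * g (x - y) \<le> f' y * g' (x - y)"
      by eventually_elim (auto intro!: mult_mono)
    then have "AE y in lborel. 0 \<le> f y * g (x - y)"
       "AE y in lborel. f y * g (x - y) \<le> f' y * g' (x - y)" by auto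
    then show ?case
      unfolding convolution_lborel[OF m(1,2)] convolution_lborel[OF m(3,4)]
      using elim by (auto intro: integral_nonneg_AE integral_mono_AE)
  qed
qed

lemma integrable_conv_power:
  assumes "integrable lborel f" "n \<ge> 1"
  shows "integrable lborel (conv_power n f)"
  using assms(2)
  by (induction n rule: dec_induct)
    (simp_all add: conv_power_1[simplified] conv_power_Suc integrable_convolution assms(1))

lemma fourier_conv_power:
  assumes "integrable lborel f" "n \<ge> 1"
  shows "fourier (conv_power n f) k = fourier f k ^ n"
  using assms(2)
  by (induction n rule: dec_induct)
    (simp_all add: conv_power_1[simplified] conv_power_Suc fourier_convolution integrable_conv_power assms(1))

lemma conv_power_mono_AE:
  assumes "integrable lborel f" "integrable lborel g" "AE x in lborel. 0 \<le> f x \<and> f x \<le> g x" "n \<ge> 1"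
  shows "AE x in lborel. 0 \<le> conv_power n f x \<and> conv_power n f x \<le> conv_power n g x"
  using assms(4)
proof (induction n rule: dec_induct)
  case base
  then show ?case using assms(3) by (simp add: conv_power_1[simplified])
next
  case (step n)
  then show ?case
    unfolding conv_power_Suc[OF step(1)]
    using assms by (intro convolution_mono_AE integrable_conv_power)
qed

text \<open>
  Convolution depends only on the almost everywhere classes of its factors, and does so at every
  point, since a reflected translate of a null set is a null set.  This passes from Lebesgue
  measurable functions to Borel representatives, for which Fubini's theorem is available.
\<close>

lemma convolution_cong_AE:
  fixes f g f' g' :: "real^'d \<Rightarrow> real"
  assumes [measurable]: "f \<in> borel_measurable lebesgue" "g \<in> borel_measurable lebesgue"
    and f: "AE x in lebesgue. f x = f' x" and g: "AE x in lebesgue. g x = g' x"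
    and m: "f' \<in> borel_measurable borel" "g' \<in> borel_measurable borel"
  shows "convolution f g = convolution f' g'"
proof
  fix x :: "real^'d"
  have "AE x in lborel. g x = g' x" using g by (simp add: AE_completion_iff)
  then have "AE y in lborel. g (x - y) = g' (x - y)"
    using AE_lborel_affine[of "\<lambda>x. g x = g' x" "- 1" x] by simp
  then have "AE y in lebesgue. g (x - y) = g' (x - y)" by (rule AE_completion)
  with f have eq: "AE y in lebesgue. f' y * g' (x - y) = f y * g (x - y)"
    by eventually_elim simp
  have m': "(\<lambda>y. f' y * g' (x - y)) \<in> borel_measurable lebesgue"
    using measurable_convolution_integrand[OF m, of x] by (intro measurable_completion) simp
  from borel_measurable_AE[OF this eq] m' eq
  show "convolution f g x = convolution f' g' x"
    unfolding convolution_def by (intro integral_cong_AE) auto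
qed

lemma conv_power_cong_AE:
  fixes f f' :: "real^'d \<Rightarrow> real"
  assumes f: "f \<in> borel_measurable lebesgue" and f': "integrable lborel f'"
    and eq: "AE x in lebesgue. f x = f' x" and "n \<ge> 1"
  shows "AE x in lebesgue. conv_power n f x = conv_power n f' x"
proof -
  have "conv_power n f \<in> borel_measurable lebesgue \<and> (AE x in lebesgue. conv_power n f x = conv_power n f' x)"
    using \<open>n \<ge> 1\<close>
  proof (induction n rule: dec_induct)
    case base
    then show ?case using f eq by (simp add: conv_power_1[simplified])
  next
    case (step n)
    have m: "f' \<in> borel_measurable borel" "conv_power n f' \<in> borel_measurable borel"
      using borel_measurable_integrable[OF f'] borel_measurable_integrable[OF integrable_conv_power[OF f' step(1)]]
      by auto
    have "convolution f (conv_power n f) = convolution f' (conv_power n f')"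
      using step.IH by (intro convolution_cong_AE f eq m) auto
    moreover have "convolution f' (conv_power n f') \<in> borel_measurable lebesgue"
      using borel_measurable_convolution[OF m] by (intro measurable_completion) simp
    ultimately show ?case using step(1) by (simp add: conv_power_Suc)
  qed
  then show ?thesis ..
qed

section \<open>The polynomial \<open>Q\<close>\<close>

lemma t_Q_props:
  assumes "\<exists>n\<in>{2..N}. a n > 0"
  shows t_Q_pos: "t_Q N a > 0"
    and t_Q_critical: "(\<Sum>n=2..N. real (a n) * (real n * t_Q N a ^ (n - 1))) = 1"
  using theI'[OF t_Q_unique[OF assms], folded t_Q_def] by (auto simp: deriv_Q_poly)

lemma power_ge_tangent:
  fixes s t :: real
  assumes "s > 0" "t \<ge> 0" "n \<ge> 1"
  shows "s ^ n + real n * s ^ (n - 1) * (t - s) \<le> t ^ n"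
proof -
  have "1 + real n * (t / s - 1) \<le> (1 + (t / s - 1)) ^ n"
    using assms by (intro Bernoulli_inequality) auto
  then have "s ^ n * (1 + real n * (t / s - 1)) \<le> s ^ n * (t / s) ^ n"
    using assms by (intro mult_left_mono) auto
  moreover have "s ^ n * (t / s) ^ n = t ^ n"
    using assms by (simp add: power_divide)
  moreover have "s ^ n * (1 + real n * (t / s - 1)) = s ^ n + real n * s ^ (n - 1) * (t - s)"
    using assms by (cases n) (simp_all add: field_simps)
  ultimately show ?thesis by simp
qed

text \<open>
  Each \<open>t\<^sup>n\<close> lies above its tangent at the critical point, and there the weighted slopes
  add up to \<open>1\<close>, the slope of the linear term of \<open>Q\<close>.
\<close>

lemma Q_poly_le_t_Q:
  assumes a: "\<exists>n\<in>{2..N}. a n > 0" and "t \<ge> 0"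
  shows "Q_poly N a t \<le> Q_poly N a (t_Q N a)"
proof -
  let ?T = "t_Q N a"
  have "(\<Sum>n=2..N. real (a n) * ?T ^ n) + (t - ?T)
      = (\<Sum>n=2..N. real (a n) * ?T ^ n) + (\<Sum>n=2..N. real (a n) * (real n * ?T ^ (n - 1))) * (t - ?T)"
    by (simp only: t_Q_critical[OF a] mult_1)
  also have "\<dots> = (\<Sum>n=2..N. real (a n) * (?T ^ n + real n * ?T ^ (n - 1) * (t - ?T)))"
    by (simp only: sum_distrib_right sum.distrib[symmetric] distrib_left mult.assoc)
  also have "\<dots> \<le> (\<Sum>n=2..N. real (a n) * t ^ n)"
    using power_ge_tangent[OF t_Q_pos[OF a] \<open>t \<ge> 0\<close>] by (intro sum_mono mult_left_mono) auto
  finally show ?thesis by (simp add: Q_poly_def)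
qed

lemma norm_power_diff_le:
  fixes z w :: complex
  assumes "norm z \<le> r" "norm w \<le> r"
  shows "norm (z ^ n - w ^ n) \<le> real n * r ^ (n - 1) * norm (z - w)"
proof -
  have r: "r \<ge> 0" using assms norm_ge_zero order_trans by blast
  have "norm (\<Sum>i<n. w ^ (n - Suc i) * z ^ i) \<le> (\<Sum>i<n. r ^ (n - 1))"
  proof (rule sum_norm_le)
    fix i assume i: "i \<in> {..<n}"
    have "norm (w ^ (n - Suc i) * z ^ i) \<le> r ^ (n - Suc i) * r ^ i"
      unfolding norm_mult norm_power using assms r by (intro mult_mono power_mono) auto
    also have "\<dots> = r ^ (n - 1)" using i by (simp flip: power_add)
    finally show "norm (w ^ (n - Suc i) * z ^ i) \<le> r ^ (n - 1)" .
  qed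
  then have "norm (z - w) * norm (\<Sum>i<n. w ^ (n - Suc i) * z ^ i) \<le> norm (z - w) * (real n * r ^ (n - 1))"
    by (intro mult_left_mono) auto
  then show ?thesis
    by (simp add: power_diff_sumr2 norm_mult mult_ac)
qed

text \<open>
  With \<open>r = max |z| |w|\<close> the map \<open>\<Sum> a\<^sub>n z\<^sup>n\<close> has Lipschitz constant \<open>\<Sum> n a\<^sub>n r\<^bsup>n-1\<^esup>\<close> on the
  disc of radius \<open>r\<close>.  This sum is smaller than its value \<open>1\<close> at the critical point.
\<close>

lemma Q_poly_inj_on_disc:
  fixes z w :: complex
  assumes a: "\<exists>n\<in>{2..N}. a n > 0" and z: "norm z < t_Q N a" and w: "norm w < t_Q N a"
    and eq: "z - (\<Sum>n=2..N. of_nat (a n) * z ^ n) = w - (\<Sum>n=2..N. of_nat (a n) * w ^ n)"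
  shows "z = w"
proof (rule ccontr)
  assume "z \<noteq> w"
  define r where "r = max (norm z) (norm w)"
  let ?T = "t_Q N a"
  have r: "0 \<le> r" "r < ?T" using z w by (auto simp: r_def le_max_iff_disj)
  obtain m where m: "m \<in> {2..N}" "a m > 0" using a by blast
  have "(\<Sum>n=2..N. real (a n) * (real n * r ^ (n - 1))) < (\<Sum>n=2..N. real (a n) * (real n * ?T ^ (n - 1)))"
  proof (rule sum_strict_mono_ex1)
    show "\<forall>n\<in>{2..N}. real (a n) * (real n * r ^ (n - 1)) \<le> real (a n) * (real n * ?T ^ (n - 1))"
      using r by (auto intro!: mult_left_mono power_mono)
    have "r ^ (m - 1) < ?T ^ (m - 1)" using r m by (intro power_strict_mono) auto
    then show "\<exists>n\<in>{2..N}. real (a n) * (real n * r ^ (n - 1)) < real (a n) * (real n * ?T ^ (n - 1))"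
      using m by (intro bexI[of _ m]) auto
  qed simp
  also have "\<dots> = 1" by (rule t_Q_critical[OF a])
  finally have less: "(\<Sum>n=2..N. real (a n) * (real n * r ^ (n - 1))) < 1" .
  have zw: "z - w = (\<Sum>n=2..N. of_nat (a n) * (z ^ n - w ^ n))"
    using eq by (simp add: sum_subtractf right_diff_distrib algebra_simps)
  have "norm (z - w) \<le> (\<Sum>n=2..N. real (a n) * norm (z ^ n - w ^ n))"
    using norm_sum[of "\<lambda>n. of_nat (a n) * (z ^ n - w ^ n)" "{2..N}"]
    by (simp only: zw[symmetric] norm_mult norm_of_nat)
  also have "\<dots> \<le> (\<Sum>n=2..N. real (a n) * (real n * r ^ (n - 1) * norm (z - w)))"
    by (intro sum_mono mult_left_mono norm_power_diff_le) (auto simp: r_def)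
  also have "\<dots> = (\<Sum>n=2..N. real (a n) * (real n * r ^ (n - 1))) * norm (z - w)"
    by (simp add: sum_distrib_right mult.assoc)
  also have "\<dots> < 1 * norm (z - w)"
    using less \<open>z \<noteq> w\<close> by (intro mult_strict_right_mono) auto
  finally show False by simp
qed

section \<open>A non-negative solution by monotone iteration\<close>

text \<open>
  The supremum is taken in the extended non-negative reals, where it always exists; the bound on
  the integrals makes it finite almost everywhere.
\<close>

lemma L1_monotone_limit:
  fixes s :: "nat \<Rightarrow> 'a \<Rightarrow> real"
  assumes int: "\<And>i. integrable M (s i)"
    and mono: "\<And>i. AE x in M. 0 \<le> s i x \<and> s i x \<le> s (Suc i) x"
    and bound: "\<And>i. (\<integral>x. s i x \<partial>M) \<le> B"
  obtains g where "integrable M g" "AE x in M. 0 \<le> g x" "(\<integral>x. g x \<partial>M) \<le> B"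
    "AE x in M. (\<lambda>i. s i x) \<longlonglongrightarrow> g x" "AE x in M. \<forall>i. s i x \<le> g x"
proof -
  have [measurable]: "s i \<in> borel_measurable M" for i using int by auto
  define G where "G x = (SUP i. ennreal (s i x))" for x
  have [measurable]: "G \<in> borel_measurable M" unfolding G_def[abs_def] by measurable
  have m: "AE x in M. \<forall>i. 0 \<le> s i x \<and> s i x \<le> s (Suc i) x"
    using mono by (simp add: AE_all_countable)
  have "0 \<le> (\<integral>x. s 0 x \<partial>M)"
    using mono[of 0] by (intro integral_nonneg_AE) auto
  with bound[of 0] have B: "0 \<le> B" by simp
  have "(\<integral>\<^sup>+x. G x \<partial>M) = (SUP i. \<integral>\<^sup>+x. ennreal (s i x) \<partial>M)"
    unfolding G_def
  proof (rule nn_integral_monotone_convergence_SUP_AE)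
    show "AE x in M. ennreal (s i x) \<le> ennreal (s (Suc i) x)" for i
      using mono[of i] by eventually_elim (simp add: ennreal_leI)
  qed simp
  also have "\<dots> \<le> ennreal B"
  proof (rule SUP_least)
    fix i
    have "(\<integral>\<^sup>+x. ennreal (s i x) \<partial>M) = ennreal (\<integral>x. s i x \<partial>M)"
      using mono[of i] by (intro nn_integral_eq_integral int) auto
    then show "(\<integral>\<^sup>+x. ennreal (s i x) \<partial>M) \<le> ennreal B"
      using bound[of i] by (simp add: ennreal_leI)
  qed
  finally have G_le: "(\<integral>\<^sup>+x. G x \<partial>M) \<le> ennreal B" .
  have "(\<integral>\<^sup>+x. G x \<partial>M) < \<infinity>"
    by (rule le_less_trans[OF G_le]) simp
  then have fin: "AE x in M. G x \<noteq> \<infinity>"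
    by (intro nn_integral_PInf_AE) simp_all
  let ?g = "\<lambda>x. enn2real (G x)"
  have nn: "(\<integral>\<^sup>+x. ennreal (?g x) \<partial>M) = (\<integral>\<^sup>+x. G x \<partial>M)"
    using fin by (intro nn_integral_cong_AE, eventually_elim) (simp add: less_top)
  have ig: "integrable M ?g"
  proof (rule integrableI_bounded)
    show "(\<integral>\<^sup>+x. ennreal (norm (?g x)) \<partial>M) < \<infinity>"
      using le_less_trans[OF G_le] by (simp add: nn)
  qed simp
  have ib: "(\<integral>x. ?g x \<partial>M) \<le> B"
    using nn G_le B by (subst integral_eq_nn_integral) (auto intro!: enn2real_leI)
  have lim: "AE x in M. (\<lambda>i. s i x) \<longlonglongrightarrow> ?g x"
    using fin m
  proof eventually_elim
    case (elim x)
    have "incseq (\<lambda>i. ennreal (s i x))"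
      using elim by (intro incseq_SucI ennreal_leI) simp
    then have "(\<lambda>i. ennreal (s i x)) \<longlonglongrightarrow> G x"
      unfolding G_def by (rule LIMSEQ_SUP)
    then have "(\<lambda>i. enn2real (ennreal (s i x))) \<longlonglongrightarrow> ?g x"
      using elim by (intro tendsto_enn2real) (auto simp: less_top)
    then show ?case using elim by simp
  qed
  have le: "AE x in M. \<forall>i. s i x \<le> ?g x"
    using fin m
  proof eventually_elim
    case (elim x)
    show ?case
    proof
      fix i
      have "ennreal (s i x) \<le> G x" unfolding G_def by (rule SUP_upper) simp
      then have "enn2real (ennreal (s i x)) \<le> ?g x"
        using elim by (intro enn2real_mono) (auto simp: less_top)
      then show "s i x \<le> ?g x" using elim by simp
    qed
  qed
  show thesis by (rule that[OF ig _ ib lim le]) simp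
qed

text \<open>
  Iterates for the fixed-point equation \<open>g = u + \<Sum> a\<^sub>n (*\<^sup>n g)\<close>.
\<close>

primrec picard :: "nat \<Rightarrow> (nat \<Rightarrow> nat) \<Rightarrow> (real^'d \<Rightarrow> real) \<Rightarrow> nat \<Rightarrow> real^'d \<Rightarrow> real" where
  "picard N a u 0 = (\<lambda>x. 0)"
| "picard N a u (Suc i) = (\<lambda>x. u x + (\<Sum>n=2..N. real (a n) * conv_power n (picard N a u i) x))"

context
  fixes N :: nat and a :: "nat \<Rightarrow> nat" and u :: "real^'d \<Rightarrow> real"
  assumes u: "integrable lborel u"
begin

lemma integrable_picard: "integrable lborel (picard N a u i)"
proof (induction i)
  case (Suc i)
  show ?case
    unfolding picard.simps
    by (intro Bochner_Integration.integrable_add Bochner_Integration.integrable_sum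
        integrable_mult_right integrable_conv_power u Suc) auto
qed simp

lemma fourier_picard_Suc:
  "fourier (picard N a u (Suc i)) k
    = fourier u k + (\<Sum>n=2..N. of_nat (a n) * fourier (picard N a u i) k ^ n)"
proof -
  have int: "integrable lborel (\<lambda>x. real (a n) * conv_power n (picard N a u i) x)" if "n \<in> {2..N}" for n
    using that by (intro integrable_mult_right integrable_conv_power integrable_picard) auto
  have "fourier (picard N a u (Suc i)) k = fourier u k
      + fourier (\<lambda>x. \<Sum>n=2..N. real (a n) * conv_power n (picard N a u i) x) k"
    unfolding picard.simps by (intro fourier_add u Bochner_Integration.integrable_sum int)
  also have "fourier (\<lambda>x. \<Sum>n=2..N. real (a n) * conv_power n (picard N a u i) x) k
      = (\<Sum>n=2..N. fourier (\<lambda>x. real (a n) * conv_power n (picard N a u i) x) k)"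
    by (rule fourier_sum) (rule int)
  finally show ?thesis
    by (simp add: fourier_cmult fourier_conv_power integrable_picard)
qed

lemma picard_mono_AE:
  assumes "AE x in lborel. 0 \<le> u x"
  shows "AE x in lborel. 0 \<le> picard N a u i x \<and> picard N a u i x \<le> picard N a u (Suc i) x"
proof (induction i)
  case 0
  have "conv_power n (\<lambda>_. 0) x = 0" if "n \<in> {2..N}" for n and x :: "real^'d"
    using that by (cases n; cases "n - 1") (auto simp: conv_power_def convolution_def)
  then show ?case using assms by simp
next
  case (Suc i)
  have "AE x in lborel. \<forall>n\<in>{2..N}. 0 \<le> conv_power n (picard N a u i) x
      \<and> conv_power n (picard N a u i) x \<le> conv_power n (picard N a u (Suc i)) x"
    using conv_power_mono_AE[OF integrable_picard integrable_picard Suc]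
    by (intro AE_ball_countable[THEN iffD2]) auto
  with assms show ?case
  proof eventually_elim
    case (elim x)
    then have "0 \<le> (\<Sum>n=2..N. real (a n) * conv_power n (picard N a u i) x)"
      by (intro sum_nonneg) auto
    moreover have "(\<Sum>n=2..N. real (a n) * conv_power n (picard N a u i) x)
        \<le> (\<Sum>n=2..N. real (a n) * conv_power n (picard N a u (Suc i)) x)"
      using elim by (intro sum_mono mult_left_mono) auto
    ultimately show ?case using elim by simp
  qed
qed

lemma integral_picard_le:
  assumes nonneg: "AE x in lborel. 0 \<le> u x" and "t \<ge> 0" and le: "(\<integral>x. u x \<partial>lborel) \<le> Q_poly N a t"
  shows "(\<integral>x. picard N a u i x \<partial>lborel) \<le> t"
proof (induction i)
  case (Suc i)
  have "0 \<le> (\<integral>x. picard N a u i x \<partial>lborel)"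
    using picard_mono_AE[OF nonneg, of i] by (intro integral_nonneg_AE) auto
  then have "(\<Sum>n=2..N. real (a n) * (\<integral>x. picard N a u i x \<partial>lborel) ^ n) \<le> (\<Sum>n=2..N. real (a n) * t ^ n)"
    using Suc by (intro sum_mono mult_left_mono power_mono) auto
  moreover have "complex_of_real (\<integral>x. picard N a u (Suc i) x \<partial>lborel)
      = of_real ((\<integral>x. u x \<partial>lborel) + (\<Sum>n=2..N. real (a n) * (\<integral>x. picard N a u i x \<partial>lborel) ^ n))"
    using fourier_picard_Suc[of i 0] by (simp add: fourier_0 del: picard.simps)
  then have "(\<integral>x. picard N a u (Suc i) x \<partial>lborel)
      = (\<integral>x. u x \<partial>lborel) + (\<Sum>n=2..N. real (a n) * (\<integral>x. picard N a u i x \<partial>lborel) ^ n)"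
    by (simp only: of_real_eq_iff)
  ultimately show ?case using le by (simp add: Q_poly_def)
qed (use \<open>t \<ge> 0\<close> in simp)

text \<open>
  The fixed-point equation is passed to the limit on the Fourier side only, where it is a polynomial
  identity at each frequency and dominated convergence suffices.
\<close>

lemma ex_positive_solution:
  assumes nonneg: "AE x in lborel. 0 \<le> u x" and "t \<ge> 0" and le: "(\<integral>x. u x \<partial>lborel) \<le> Q_poly N a t"
  obtains g where "integrable lborel g" "AE x in lborel. 0 \<le> g x" "(\<integral>x. g x \<partial>lborel) \<le> t"
    "\<And>k. fourier g k - (\<Sum>n=2..N. of_nat (a n) * fourier g k ^ n) = fourier u k"
proof -
  obtain g where g: "integrable lborel g" "AE x in lborel. 0 \<le> g x" "(\<integral>x. g x \<partial>lborel) \<le> t"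
    and lim: "AE x in lborel. (\<lambda>i. picard N a u i x) \<longlonglongrightarrow> g x"
    and le_g: "AE x in lborel. \<forall>i. picard N a u i x \<le> g x"
    using L1_monotone_limit[where M=lborel and s="picard N a u" and B=t, OF integrable_picard picard_mono_AE[OF nonneg] integral_picard_le[OF assms]] by blast
  have F: "(\<lambda>i. fourier (picard N a u i) k) \<longlonglongrightarrow> fourier g k" for k
  proof (rule fourier_tendsto[OF integrable_picard g(1) lim])
    show "AE x in lborel. \<bar>picard N a u i x\<bar> \<le> g x" for i
      using le_g picard_mono_AE[OF nonneg, of i] by eventually_elim simp
  qed (use g in auto)
  have "fourier g k = fourier u k + (\<Sum>n=2..N. of_nat (a n) * fourier g k ^ n)" for k
  proof (rule LIMSEQ_unique)
    show "(\<lambda>i. fourier (picard N a u (Suc i)) k) \<longlonglongrightarrow> fourier g k"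
      using F by (rule LIMSEQ_Suc)
    show "(\<lambda>i. fourier (picard N a u (Suc i)) k)
        \<longlonglongrightarrow> fourier u k + (\<Sum>n=2..N. of_nat (a n) * fourier g k ^ n)"
      unfolding fourier_picard_Suc by (intro tendsto_intros F)
  qed
  then show thesis by (intro that[OF g]) (simp add: algebra_simps)
qed

end

section \<open>Identification of the two solutions\<close>

text \<open>
  The set where \<open>F = G\<close> is closed in \<open>S\<close>; it is also the set where \<open>norm F < r\<close>, hence open in \<open>S\<close>.
\<close>

lemma connected_subset_where_less:
  fixes F G :: "'a::topological_space \<Rightarrow> complex"
  assumes S: "connected S" and cont: "continuous_on S F" "continuous_on S G"
    and G: "\<And>x. x \<in> S \<Longrightarrow> norm (G x) < r"
    and inj: "\<And>x. x \<in> S \<Longrightarrow> norm (F x) < r \<Longrightarrow> F x = G x"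
    and ex: "x0 \<in> S" "norm (F x0) < r" and "x \<in> S"
  shows "F x = G x"
proof -
  let ?E = "{x \<in> S. F x - G x = 0}"
  have eq: "?E = S \<inter> (\<lambda>x. norm (F x)) -` {..<r}"
  proof (intro set_eqI iffI)
    fix y assume "y \<in> ?E"
    then show "y \<in> S \<inter> (\<lambda>x. norm (F x)) -` {..<r}" using G[of y] by simp
  next
    fix y assume "y \<in> S \<inter> (\<lambda>x. norm (F x)) -` {..<r}"
    then show "y \<in> ?E" using inj[of y] by simp
  qed
  have "closedin (top_of_set S) ?E"
    by (intro continuous_closedin_preimage_constant continuous_intros cont)
  moreover have "openin (top_of_set S) ?E"
    unfolding eq by (intro continuous_openin_preimage_gen continuous_intros cont)
  moreover have "x0 \<in> ?E" using inj[OF ex] ex(1) by simp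
  ultimately have "?E = S"
    using S unfolding connected_clopen by blast
  with \<open>x \<in> S\<close> have "x \<in> ?E" by blast
  then show ?thesis by simp
qed

text \<open>
  The function \<open>g\<close> obtained below is the non-negative solution built by iteration from
  \<open>u = f - \<Sum> a\<^sub>n (*\<^sup>n f)\<close>; the proof consists in showing that \<open>f\<close> and \<open>g\<close> have the same transform.
\<close>

theorem convolution_inequality_lborel:
  fixes N :: nat and a :: "nat \<Rightarrow> nat" and f :: "real^'d \<Rightarrow> real"
  assumes a: "\<exists>n\<in>{2..N}. a n > 0"
    and f: "integrable lborel f" and pos: "(\<integral>x. f x \<partial>lborel) \<ge> 0"
    and ineq: "AE x in lborel. f x \<ge> (\<Sum>n=2..N. real (a n) * conv_power n f x)"
  shows "(AE x in lborel. f x \<ge> 0) \<and> (\<integral>x. \<bar>f x\<bar> \<partial>lborel) \<le> t_Q N a"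
proof -
  let ?T = "t_Q N a"
  have T: "?T > 0" by (rule t_Q_pos[OF a])
  define u where "u x = f x - (\<Sum>n=2..N. real (a n) * conv_power n f x)" for x
  have ic: "integrable lborel (\<lambda>x. real (a n) * conv_power n f x)" if "n \<in> {2..N}" for n
    using that by (intro integrable_mult_right integrable_conv_power f) auto
  have isum: "integrable lborel (\<lambda>x. \<Sum>n=2..N. real (a n) * conv_power n f x)"
    using ic by (rule Bochner_Integration.integrable_sum)
  have u: "integrable lborel u"
    unfolding u_def[abs_def] using f isum by (rule Bochner_Integration.integrable_diff)
  have u_nonneg: "AE x in lborel. 0 \<le> u x"
    using ineq by (simp add: u_def)
  have Fu: "fourier u k = fourier f k - (\<Sum>n=2..N. of_nat (a n) * fourier f k ^ n)" for k
  proof -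
    have "fourier u k = fourier f k - (\<Sum>n=2..N. fourier (\<lambda>x. real (a n) * conv_power n f x) k)"
      unfolding u_def[abs_def] fourier_diff[OF f isum] by (subst fourier_sum) (rule ic, auto)
    then show ?thesis by (simp add: fourier_cmult fourier_conv_power f)
  qed
  have "complex_of_real (\<integral>x. u x \<partial>lborel) = of_real (Q_poly N a (\<integral>x. f x \<partial>lborel))"
    using Fu[of 0] by (simp add: fourier_0 Q_poly_def)
  then have "(\<integral>x. u x \<partial>lborel) = Q_poly N a (\<integral>x. f x \<partial>lborel)"
    by (simp only: of_real_eq_iff)
  then have "(\<integral>x. u x \<partial>lborel) \<le> Q_poly N a ?T"
    using Q_poly_le_t_Q[OF a pos] by simp
  then obtain g where g: "integrable lborel g" and g_nonneg: "AE x in lborel. 0 \<le> g x"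
    and g_le: "(\<integral>x. g x \<partial>lborel) \<le> ?T"
    and Fg: "\<And>k. fourier g k - (\<Sum>n=2..N. of_nat (a n) * fourier g k ^ n) = fourier u k"
    by (rule ex_positive_solution[OF u u_nonneg less_imp_le[OF T]]) (rule that)
  have g_abs: "(\<integral>x. \<bar>g x\<bar> \<partial>lborel) = (\<integral>x. g x \<partial>lborel)"
    using g_nonneg g by (intro integral_cong_AE) auto
  \<comment> \<open>Only \<open>k = 0\<close> can reach the bound, when \<open>\<integral>g = T\<close>; it is recovered by continuity at the end.\<close>
  have small: "norm (fourier g k) < ?T" if "k \<noteq> 0" for k
  proof (cases "(\<integral>x. g x \<partial>lborel) > 0")
    case True
    show ?thesis using norm_fourier_less[OF g g_nonneg True that] g_le by simp
  next
    case False
    then show ?thesis using norm_fourier_le[OF g, of k] T by (simp add: g_abs)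
  qed
  have eq: "fourier f k = fourier g k" if k: "k \<noteq> 0" for k
  proof -
    let ?F = "\<lambda>s::real. fourier f (s *\<^sub>R k)" and ?G = "\<lambda>s::real. fourier g (s *\<^sub>R k)"
    have "eventually (\<lambda>k. norm (fourier f k) < ?T) at_infinity"
      using tendsto_norm[OF Riemann_Lebesgue[OF f]] T by (intro order_tendstoD(2)) auto
    then obtain b where b: "\<And>k. norm k \<ge> b \<Longrightarrow> norm (fourier f k) < ?T"
      unfolding eventually_at_infinity by blast
    \<comment> \<open>A point on the ray through \<open>k\<close> beyond radius \<open>b\<close>, and not closer to \<open>0\<close> than \<open>k\<close>.\<close>
    define s where "s = max 1 (b / norm k)"
    have "b \<le> s * norm k"
      using k by (simp add: s_def pos_divide_le_eq[symmetric])
    then have s: "norm (?F s) < ?T"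
      by (intro b) (simp add: s_def)
    have "?F 1 = ?G 1"
    proof (rule connected_subset_where_less[of "{1..}" ?F ?G ?T s])
      show "continuous_on {1..} ?F" "continuous_on {1..} ?G"
        by (intro continuous_on_compose2[OF continuous_on_fourier] continuous_intros f g; simp)+
      show G_small: "norm (?G x) < ?T" if "x \<in> {1..}" for x
        using that k by (intro small) auto
      show "?F x = ?G x" if "x \<in> {1..}" "norm (?F x) < ?T" for x
        by (rule Q_poly_inj_on_disc[OF a that(2) G_small[OF that(1)]
              trans[OF Fu[symmetric] Fg[symmetric]]])
    qed (use s in \<open>auto simp: s_def\<close>)
    then show ?thesis by simp
  qed
  have "fourier f k = fourier g k" for k
  proof (cases "k = 0")
    case True
    have lim: "(fourier f \<longlongrightarrow> fourier f 0) (at 0)" "(fourier g \<longlongrightarrow> fourier g 0) (at 0)"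
      using continuous_on_fourier[OF f] continuous_on_fourier[OF g] by (auto simp: continuous_on_def)
    have "eventually (\<lambda>k. fourier f k = fourier g k) (at 0)"
      unfolding eventually_at_filter by (intro always_eventually allI impI eq)
    then have "(fourier g \<longlongrightarrow> fourier f 0) (at 0)"
      using lim(1) by (rule tendsto_cong[THEN iffD1])
    then have "fourier f 0 = fourier g 0"
      using lim(2) by (rule tendsto_unique[OF at_neq_bot])
    with True show ?thesis by simp
  qed (rule eq)
  then have fg: "AE x in lborel. f x = g x"
    by (rule fourier_inject_AE[OF f g])
  then have "(\<integral>x. \<bar>f x\<bar> \<partial>lborel) = (\<integral>x. \<bar>g x\<bar> \<partial>lborel)"
    using f g by (intro integral_cong_AE) auto
  moreover have "AE x in lborel. f x \<ge> 0"
    using fg g_nonneg by eventually_elim simp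
  ultimately show ?thesis using g_abs g_le by simp
qed

text \<open>
  Passing to a Borel representative \<open>h\<close> of \<open>f\<close> changes neither the integrals nor, up to null sets,
  the convolution powers.
\<close>

theorem theorem1p2:
  fixes N :: nat and a :: "nat \<Rightarrow> nat" and f :: "real^'d \<Rightarrow> real"
  assumes "N \<ge> 2"
    and "\<exists>n\<in>{2..N}. a n > 0"
    and "integrable lebesgue f"
    and "(LINT x|lebesgue. f x) \<ge> 0"
    and "AE x in lebesgue. f x \<ge> (\<Sum>n=2..N. real (a n) * conv_power n f x)"
  shows "(AE x in lebesgue. f x \<ge> 0) \<and> (LINT x|lebesgue. \<bar>f x\<bar>) \<le> t_Q N a"
proof -
  have fm: "f \<in> borel_measurable lebesgue" using assms(3) by auto
  then obtain h where h: "h \<in> borel_measurable lborel" "AE x in lborel. f x = h x"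
    using completion_ex_borel_measurable_real by blast
  have hm: "h \<in> borel_measurable lebesgue" using h(1) by (rule measurable_completion)
  have eq: "AE x in lebesgue. f x = h x" using h(2) by (rule AE_completion)
  have "integrable lebesgue h"
    using assms(3) integrable_cong_AE[OF fm hm eq] by simp
  then have int: "integrable lborel h"
    using integrable_completion[OF h(1)] by simp
  have "(\<integral>x. f x \<partial>lebesgue) = (\<integral>x. h x \<partial>lborel)"
    using integral_cong_AE[OF fm hm eq] integral_completion[OF h(1)] by simp
  with assms(4) have nonneg: "(\<integral>x. h x \<partial>lborel) \<ge> 0" by simp
  have "AE x in lebesgue. \<forall>n\<in>{2..N}. conv_power n f x = conv_power n h x"
    by (intro AE_ball_countable[THEN iffD2] ballI conv_power_cong_AE[OF fm int eq]) auto
  with assms(5) eq have "AE x in lebesgue. h x \<ge> (\<Sum>n=2..N. real (a n) * conv_power n h x)"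
    by eventually_elim simp
  then have "AE x in lborel. h x \<ge> (\<Sum>n=2..N. real (a n) * conv_power n h x)"
    by (simp add: AE_completion_iff)
  from convolution_inequality_lborel[OF assms(2) int nonneg this]
  have res: "AE x in lborel. h x \<ge> 0" "(\<integral>x. \<bar>h x\<bar> \<partial>lborel) \<le> t_Q N a" by auto
  have "(\<integral>x. \<bar>f x\<bar> \<partial>lebesgue) = (\<integral>x. \<bar>h x\<bar> \<partial>lebesgue)"
    using eq fm hm by (intro integral_cong_AE) auto
  also have "\<dots> = (\<integral>x. \<bar>h x\<bar> \<partial>lborel)"
    using h(1) by (intro integral_completion) auto
  finally have "(\<integral>x. \<bar>f x\<bar> \<partial>lebesgue) \<le> t_Q N a" using res(2) by simp
  moreover have "AE x in lebesgue. f x \<ge> 0"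
    using eq AE_completion[OF res(1)] by eventually_elim simp
  ultimately show ?thesis by blast
qed

end
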